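(* Let $\mathfrak g$ be a semisimple simply-laced Lie algebra, $\mathbf R=(R_i)_{i\in I}$ an integral collection of parameters, and $p=y_{\mathbf R}z_{\mathbf S}^{-1}$ an $\mathbf R$-monomial datum. Then $p$ is regular if and only if it is an element of the product monomial crystal $\mathcal B(\lambda,\mathbf R)$, where $\lambda=\sum_i|R_i|\varpi_i$.
   Context: $I$ is the Dynkin vertex set, $\varpi_i$ are the fundamental coweights of $\mathfrak g$; $i\sim j$ means $i,j$ are joined by an edge. Fix a partition $I=I_{\bar 0}\sqcup I_{\bar 1}$ such that every edge joins the two parts; an integer $k$ and $i\in I$ have the same parity if $i\in I_{\bar k}$. A collection $\mathbf S=(S_i)_{i\in I}$ of finite multisets is integral if all elements of $S_i$ are integers of the same parity as $i$. For a multiset $S$, $S(k)$ is the multiplicity of $k$. $\mathcal B$ is the set of Laurent monomials $p=\prod y_{i,k}^{a_{i,k}}$ in variables $y_{i,k}$ ($i\in I$, $k\in\mathbb Z$ of the same parity as $i$). Put $z_{i,k}=y_{i,k}y_{i,k+2}/\prod_{j\sim i}y_{j,k+1}$, $\varepsilon_i^k(p)=-\sum_{l\le k}a_{i,l}$, $\varphi_i^k(p)=\sum_{l\ge k}a_{i,l}$, $\varepsilon_i=\max_k\varepsilon_i^k$, $\varphi_i=\max_k\varphi_i^k$ ($k$ of the same parity as $i$). Set $\tilde e_i(p)=0$ if $\varepsilon_i(p)=0$, otherwise $\tilde e_i(p)=z_{i,k}p$ with $k$ smallest such that $\varepsilon_i^k(p)=\varepsilon_i(p)$; $\tilde f_i(p)=0$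 if $\varphi_i(p)=0$, otherwise $\tilde f_i(p)=z_{i,k-2}^{-1}p$ with $k$ largest such that $\varphi_i^k(p)=\varphi_i(p)$. For $c\in\mathbb Z$ of the same parity as $i$, $\mathcal B(\varpi_i,c)\subset\mathcal B$ is the set of monomials obtained from $y_{i,c}$ by applying these operators. For an integer $n$ of the opposite parity to $i$, $\mathcal B(\varpi_i,n)$ is the set of monomials (in variables $y_{j,k}$ with $k$ of the opposite parity to $j$) obtained from $\mathcal B(\varpi_i,n-1)$ by replacing every $y_{j,k}$ by $y_{j,k+1}$. $\mathcal B(\lambda,\mathbf R)=\prod_{i\in I,c\in R_i}\mathcal B(\varpi_i,c)$ is the set of all products of monomials, one from each $\mathcal B(\varpi_i,c)$ (with multiplicity). For collections of multisets put $y_{\mathbf S}=\prod_{i,k\in S_i}y_{i,k}$, $z_{\mathbf S}=\prod_{i,k\in S_i}z_{i,k}$. An $\mathbf R$-monomial datum is an element $p\in\mathcal B$ of the form $p=y_{\mathbf R}z_{\mathbf S}^{-1}$ with $\mathbf S$ an integral collection of multisets ($\mathbf S$ is then uniquely determined by $p$). For $q\in\mathcal B(\varpi_i,n)$ with $i\in I_{\overline{n+1}}$, write $q=y_{i,n}z_{\mathbf U}^{-1}=\prod_{j,k}y_{j,k}^{b_{j,k}}$ for the unique collection of multisets $\mathbf U=(U_j)$, and put $$E_q(p)=\sum_{j,k}U_j(k)R_j(k+1)+\sum_{j,k}b_{j,k}S_j(k-1).$$ $p$ is regular if $E_q(p)\ge0$ for all $q\in\mathcal B(\varpi_i,n)$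 and all $i\in I$, $n\in\mathbb Z$ with $i\in I_{\overline{n+1}}$. *)

theory Defs
  imports Complex_Main "HOL-Library.Multiset" "HOL-Library.Poly_Mapping" "HOL-Library.Set_Algebras"
begin

section \<open>Dynkin data\<close>

text \<open>
  A semisimple Lie algebra enters only through its Dynkin diagram, and semisimple Lie algebras
  are classified by Cartan matrices of finite type: integer matrices with diagonal entries 2,
  nonpositive off-diagonal entries, zeros placed symmetrically, and \<open>D A\<close> symmetric positive
  definite for some positive diagonal matrix \<open>D\<close>. The matrix need not be indecomposable.
\<close>

definition finite_type_cartan_matrix :: "('i::finite \<Rightarrow> 'i \<Rightarrow> int) \<Rightarrow> bool" where
  "finite_type_cartan_matrix A \<longleftrightarrow>
     (\<forall>i. A i i = 2) \<and>
     (\<forall>i j. i \<noteq> j \<longrightarrow> A i j \<le> 0) \<and>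
     (\<forall>i j. A i j = 0 \<longleftrightarrow> A j i = 0) \<and>
     (\<exists>d :: 'i \<Rightarrow> real.
        (\<forall>i. d i > 0) \<and>
        (\<forall>i j. d i * real_of_int (A i j) = d j * real_of_int (A j i)) \<and>
        (\<forall>x :: 'i \<Rightarrow> real. (\<exists>i. x i \<noteq> 0) \<longrightarrow>
           (\<Sum>i\<in>UNIV. \<Sum>j\<in>UNIV. x i * (d i * real_of_int (A i j)) * x j) > 0))"

definition simply_laced :: "('i \<Rightarrow> 'i \<Rightarrow> int) \<Rightarrow> bool" where
  "simply_laced A \<longleftrightarrow> (\<forall>i j. i \<noteq> j \<longrightarrow> A i j \<in> {0, -1})"

definition adj :: "('i \<Rightarrow> 'i \<Rightarrow> int) \<Rightarrow> 'i \<Rightarrow> 'i \<Rightarrow> bool" where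
  "adj A i j \<longleftrightarrow> i \<noteq> j \<and> A i j \<noteq> 0"

text \<open>A partition of the vertices into an even and an odd part is given by its odd part \<open>I1\<close>.\<close>

definition parity_partition :: "('i \<Rightarrow> 'i \<Rightarrow> int) \<Rightarrow> 'i set \<Rightarrow> bool" where
  "parity_partition A I1 \<longleftrightarrow> (\<forall>i j. adj A i j \<longrightarrow> (i \<in> I1 \<longleftrightarrow> j \<notin> I1))"

definition same_parity :: "'i set \<Rightarrow> 'i \<Rightarrow> int \<Rightarrow> bool" where
  "same_parity I1 i k \<longleftrightarrow> (odd k \<longleftrightarrow> i \<in> I1)"

definition integral :: "'i set \<Rightarrow> ('i \<Rightarrow> int multiset) \<Rightarrow> bool" where
  "integral I1 S \<longleftrightarrow> (\<forall>i. \<forall>k \<in># S i. same_parity I1 i k)"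


section \<open>Laurent monomials and crystal operators\<close>

text \<open>
  The Laurent monomial \<open>\<Prod> y_{i,k}^{a_{i,k}}\<close> is represented by its finitely supported exponent
  function \<open>(i, k) \<mapsto> a_{i,k}\<close>. Hence products of monomials are written additively.
\<close>

type_synonym 'i monomial = "('i \<times> int) \<Rightarrow>\<^sub>0 int"

definition parity_monomials :: "'i set \<Rightarrow> 'i monomial set" where
  "parity_monomials I1 = {p. \<forall>(i, k) \<in> Poly_Mapping.keys p. same_parity I1 i k}"

definition y_mon :: "'i \<Rightarrow> int \<Rightarrow> 'i monomial" where
  "y_mon i k = Poly_Mapping.single (i, k) 1"

definition z_mon :: "('i::finite \<Rightarrow> 'i \<Rightarrow> int) \<Rightarrow> 'i \<Rightarrow> int \<Rightarrow> 'i monomial" where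
  "z_mon A i k = y_mon i k + y_mon i (k + 2) - (\<Sum>j | adj A j i. y_mon j (k + 1))"

text \<open>
  The sums run over the finitely many variables that occur in \<open>p\<close>. For fixed \<open>p\<close> and \<open>i\<close> the
  partial sums below take finitely many values, so the maxima exist.
\<close>

definition eps_k :: "'i \<Rightarrow> int \<Rightarrow> 'i monomial \<Rightarrow> int" where
  "eps_k i k p = - (\<Sum>l | l \<le> k \<and> (i, l) \<in> Poly_Mapping.keys p. Poly_Mapping.lookup p (i, l))"

definition phi_k :: "'i \<Rightarrow> int \<Rightarrow> 'i monomial \<Rightarrow> int" where
  "phi_k i k p = (\<Sum>l | l \<ge> k \<and> (i, l) \<in> Poly_Mapping.keys p. Poly_Mapping.lookup p (i, l))"

definition eps :: "'i set \<Rightarrow> 'i \<Rightarrow> 'i monomial \<Rightarrow> int" where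
  "eps I1 i p = Max {eps_k i k p | k. same_parity I1 i k}"

definition phi :: "'i set \<Rightarrow> 'i \<Rightarrow> 'i monomial \<Rightarrow> int" where
  "phi I1 i p = Max {phi_k i k p | k. same_parity I1 i k}"

text \<open>\<open>None\<close> is the zero of the crystal.\<close>

definition e_op :: "('i::finite \<Rightarrow> 'i \<Rightarrow> int) \<Rightarrow> 'i set \<Rightarrow> 'i \<Rightarrow> 'i monomial \<Rightarrow> 'i monomial option" where
  "e_op A I1 i p =
     (if eps I1 i p = 0 then None
      else Some (z_mon A i (LEAST k. same_parity I1 i k \<and> eps_k i k p = eps I1 i p) + p))"

definition f_op :: "('i::finite \<Rightarrow> 'i \<Rightarrow> int) \<Rightarrow> 'i set \<Rightarrow> 'i \<Rightarrow> 'i monomial \<Rightarrow> 'i monomial option" where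
  "f_op A I1 i p =
     (if phi I1 i p = 0 then None
      else Some (p - z_mon A i ((GREATEST k. same_parity I1 i k \<and> phi_k i k p = phi I1 i p) - 2)))"

inductive_set generated_crystal ::
  "('i::finite \<Rightarrow> 'i \<Rightarrow> int) \<Rightarrow> 'i set \<Rightarrow> 'i \<Rightarrow> int \<Rightarrow> 'i monomial set"
  for A :: "'i::finite \<Rightarrow> 'i \<Rightarrow> int" and I1 :: "'i set" and i :: 'i and c :: int where
  gen: "y_mon i c \<in> generated_crystal A I1 i c"
| e: "p \<in> generated_crystal A I1 i c \<Longrightarrow> e_op A I1 j p = Some q \<Longrightarrow> q \<in> generated_crystal A I1 i c"
| f: "p \<in> generated_crystal A I1 i c \<Longrightarrow> f_op A I1 j p = Some q \<Longrightarrow> q \<in> generated_crystal A I1 i c"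

text \<open>Replacing every \<open>y_{j,k}\<close> by \<open>y_{j,k+1}\<close>: the new exponent at \<open>(j, k)\<close> is the old one at
  \<open>(j, k - 1)\<close>.\<close>

definition shift :: "'i monomial \<Rightarrow> 'i monomial" where
  "shift p = Poly_Mapping.map_key (\<lambda>(j, k). (j, k - 1)) p"

lemma shift_y_mon: "shift (y_mon j k) = y_mon j (k + 1)"
proof -
  have "inj (\<lambda>(j :: 'a, k :: int). (j, k - 1))"
    by (auto simp: inj_def)
  from Poly_Mapping.map_key_single[OF this, of "(j, k + 1)" 1] show ?thesis
    by (simp add: shift_def y_mon_def)
qed

definition fundamental_crystal ::
  "('i::finite \<Rightarrow> 'i \<Rightarrow> int) \<Rightarrow> 'i set \<Rightarrow> 'i \<Rightarrow> int \<Rightarrow> 'i monomial set" where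
  "fundamental_crystal A I1 i n =
     (if same_parity I1 i n then generated_crystal A I1 i n
      else shift ` generated_crystal A I1 i (n - 1))"

text \<open>
  The crystal \<open>B(\<lambda>, R)\<close> with \<open>\<lambda> = \<Sum>i |R_i| \<varpi>_i\<close>; the weight \<open>\<lambda>\<close> is determined by \<open>R\<close>. The sums are
  elementwise sums of sets of exponent functions, i.e. elementwise products of sets of monomials.
\<close>

definition product_monomial_crystal ::
  "('i::finite \<Rightarrow> 'i \<Rightarrow> int) \<Rightarrow> 'i set \<Rightarrow> ('i \<Rightarrow> int multiset) \<Rightarrow> 'i monomial set" where
  "product_monomial_crystal A I1 R = (\<Sum>i\<in>UNIV. \<Sum>c\<in>#R i. fundamental_crystal A I1 i c)"


section \<open>Monomial data and regularity\<close>

definition y_prod :: "('i::finite \<Rightarrow> int multiset) \<Rightarrow> 'i monomial" where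
  "y_prod S = (\<Sum>i\<in>UNIV. \<Sum>k\<in>#S i. y_mon i k)"

definition z_prod :: "('i::finite \<Rightarrow> 'i \<Rightarrow> int) \<Rightarrow> ('i \<Rightarrow> int multiset) \<Rightarrow> 'i monomial" where
  "z_prod A S = (\<Sum>i\<in>UNIV. \<Sum>k\<in>#S i. z_mon A i k)"

definition monomial_datum ::
  "('i::finite \<Rightarrow> 'i \<Rightarrow> int) \<Rightarrow> 'i set \<Rightarrow> ('i \<Rightarrow> int multiset) \<Rightarrow> 'i monomial \<Rightarrow> bool" where
  "monomial_datum A I1 R p \<longleftrightarrow>
     p \<in> parity_monomials I1 \<and> (\<exists>S. integral I1 S \<and> p = y_prod R - z_prod A S)"

text \<open>The collection \<open>S\<close> with \<open>p = p0 z_S^{-1}\<close>; it is unique by \<open>z_prod_inject\<close> below.\<close>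

definition z_exponents ::
  "('i::finite \<Rightarrow> 'i \<Rightarrow> int) \<Rightarrow> 'i monomial \<Rightarrow> 'i monomial \<Rightarrow> 'i \<Rightarrow> int multiset" where
  "z_exponents A p0 p = (THE S. p = p0 - z_prod A S)"

lemma lookup_y_mon: "Poly_Mapping.lookup (y_mon j l) (i, k) = (if j = i \<and> l = k then 1 else 0)"
  by (auto simp: y_mon_def lookup_single when_def)

lemma lookup_z_mon:
  "Poly_Mapping.lookup (z_mon A j l) (i, k) =
     (if j = i \<and> l = k then 1 else 0) + (if j = i \<and> l = k - 2 then 1 else 0)
     - (if adj A i j \<and> l = k - 1 then 1 else 0)"
proof -
  have "(\<Sum>x | adj A x j. Poly_Mapping.lookup (y_mon x (l + 1)) (i, k)) =
        (\<Sum>x | adj A x j. if x = i then (if l = k - 1 then 1 else 0) else 0)"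
    by (intro sum.cong) (auto simp: lookup_y_mon)
  also have "\<dots> = (if adj A i j \<and> l = k - 1 then 1 else 0)"
    by (subst sum.delta) auto
  finally show ?thesis
    by (auto simp: z_mon_def lookup_add lookup_minus lookup_sum lookup_y_mon)
qed

lemma lookup_sum_mset_z_mon:
  "Poly_Mapping.lookup (\<Sum>l\<in>#M. z_mon A j l) (i, k) =
     (if j = i then int (count M k) else 0) + (if j = i then int (count M (k - 2)) else 0)
     - (if adj A i j then int (count M (k - 1)) else 0)"
proof (induction M)
  case empty
  show ?case by simp
next
  case (add l M)
  then show ?case by (simp add: lookup_add lookup_z_mon)
qed

lemma lookup_z_prod:
  "Poly_Mapping.lookup (z_prod A S) (i, k) =
     int (count (S i) k) + int (count (S i) (k - 2)) - (\<Sum>j | adj A i j. int (count (S j) (k - 1)))"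
proof -
  have "Poly_Mapping.lookup (z_prod A S) (i, k) =
    (\<Sum>j\<in>UNIV. (if j = i then int (count (S j) k) else 0)
      + (if j = i then int (count (S j) (k - 2)) else 0)
      - (if adj A i j then int (count (S j) (k - 1)) else 0))"
    unfolding z_prod_def lookup_sum lookup_sum_mset_z_mon ..
  also have "\<dots> = int (count (S i) k) + int (count (S i) (k - 2))
      - (\<Sum>j\<in>UNIV. if adj A i j then int (count (S j) (k - 1)) else 0)"
    by (simp add: sum.distrib sum_subtractf)
  also have "(\<Sum>j\<in>UNIV. if adj A i j then int (count (S j) (k - 1)) else 0) =
      (\<Sum>j | adj A i j. int (count (S j) (k - 1)))"
    by (simp add: sum.If_cases)
  finally show ?thesis .
qed

lemma z_prod_inject:
  fixes A :: "'i::finite \<Rightarrow> 'i \<Rightarrow> int"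
  assumes "z_prod A S = z_prod A T"
  shows "S = T"
proof (rule ccontr)
  assume "S \<noteq> T"
  define D where "D = {k. \<exists>i. count (S i) k \<noteq> count (T i) k}"
  have "D \<subseteq> (\<Union>i. set_mset (S i) \<union> set_mset (T i))"
  proof
    fix k assume "k \<in> D"
    then obtain i where i: "count (S i) k \<noteq> count (T i) k" unfolding D_def by blast
    then have "k \<in># S i \<or> k \<in># T i" by (metis not_in_iff)
    then show "k \<in> (\<Union>i. set_mset (S i) \<union> set_mset (T i))" by blast
  qed
  then have fin: "finite D"
    by (rule finite_subset) auto
  from \<open>S \<noteq> T\<close> obtain i where "S i \<noteq> T i" by auto
  then obtain k where "count (S i) k \<noteq> count (T i) k" by (auto simp: multiset_eq_iff)
  then have ne: "D \<noteq> {}" by (auto simp: D_def)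
  define m where "m = Min D"
  have "m \<in> D" using fin ne by (simp add: m_def)
  then obtain j where j: "count (S j) m \<noteq> count (T j) m" by (auto simp: D_def)
  have low: "count (S i') k = count (T i') k" if "k < m" for i' k
  proof (rule ccontr)
    assume "count (S i') k \<noteq> count (T i') k"
    then have "k \<in> D" unfolding D_def by blast
    with fin have "m \<le> k" unfolding m_def by (rule Min_le)
    with that show False by simp
  qed
  have "Poly_Mapping.lookup (z_prod A S) (j, m) = Poly_Mapping.lookup (z_prod A T) (j, m)"
    using assms by simp
  then show False
    using j unfolding lookup_z_prod by (simp add: low)
qed

lemma z_exponents_eq: "z_exponents A p0 (p0 - z_prod A S) = S"
  unfolding z_exponents_def
proof (rule the_equality)
  fix T assume "p0 - z_prod A S = p0 - z_prod A T"
  then have "z_prod A T = z_prod A S" by simp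
  then show "T = S" by (rule z_prod_inject)
qed simp

text \<open>The quantity \<open>E_q(p)\<close> for \<open>p = y_R z_S^{-1}\<close> and \<open>q = y_{i,n} z_U^{-1}\<close>.\<close>

definition E_val ::
  "('i::finite \<Rightarrow> 'i \<Rightarrow> int) \<Rightarrow> ('i \<Rightarrow> int multiset) \<Rightarrow> 'i \<Rightarrow> int \<Rightarrow> 'i monomial \<Rightarrow> 'i monomial \<Rightarrow> int" where
  "E_val A R i n q p =
     (let S = z_exponents A (y_prod R) p; U = z_exponents A (y_mon i n) q in
        (\<Sum>j\<in>UNIV. \<Sum>k\<in>set_mset (U j). int (count (U j) k) * int (count (R j) (k + 1)))
        + (\<Sum>(j, k)\<in>Poly_Mapping.keys q. Poly_Mapping.lookup q (j, k) * int (count (S j) (k - 1))))"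

definition regular ::
  "('i::finite \<Rightarrow> 'i \<Rightarrow> int) \<Rightarrow> 'i set \<Rightarrow> ('i \<Rightarrow> int multiset) \<Rightarrow> 'i monomial \<Rightarrow> bool" where
  "regular A I1 R p \<longleftrightarrow>
     (\<forall>i n. same_parity I1 i (n + 1) \<longrightarrow> (\<forall>q \<in> fundamental_crystal A I1 i n. E_val A R i n q p \<ge> 0))"

end

theory Submission
  imports Defs "HOL-Library.Z2" "HOL-Library.Function_Algebras" "HOL-Library.FuncSet"
begin

text \<open>
  Write \<open>p = y_R z_S^{-1}\<close> with exponents \<open>a_{j,k}\<close> and \<open>q = y_{i,n} z_U^{-1}\<close> with exponents \<open>b_{j,k}\<close>. Then
  \<open>E_q(p)\<close> has the two expressions \<open>\<Sum> U_j(k) R_j(k+1) + \<Sum> b_{j,k} S_j(k-1)\<close> and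
  \<open>S_i(n-1) + \<Sum> U_j(k) a_{j,k+1}\<close>. It is additive in each of its two arguments and symmetric in them.
  Multiplying \<open>q\<close> by \<open>z_{j,k}^{-1}\<close> changes it by \<open>a_{j,k+1}\<close>, and multiplying \<open>p\<close> by \<open>z_{j,k}^{-1}\<close>
  changes it by \<open>b_{j,k+1}\<close>.

  The proof replaces Kashiwara's operators by coarser moves, called steps: a monomial with
  \<open>a_{j,k+2} > 0\<close> may be lowered to \<open>p z_{j,k}^{-1}\<close>, and one with \<open>a_{j,k} < 0\<close> may be raised to
  \<open>p z_{j,k}\<close>. Steps look at a single exponent instead of comparing partial sums. Therefore a product of
  sets that are closed under lowering is closed under lowering: a positive exponent of a product is
  positive in one of the factors.

  Duality (\<open>step_closed_dual\<close>): if a set of \<open>p\<close> is closed under steps, then so is the set of all \<open>q\<close> with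
  \<open>E_q(p) \<ge> 0\<close> for all these \<open>p\<close>. Indeed, if lowering \<open>q\<close> at \<open>(j,k)\<close> decreases \<open>E_q(p)\<close>, then
  \<open>a_{j,k+1} < 0\<close>, so \<open>p\<close> may be raised at \<open>(j,k+1)\<close> until this exponent vanishes, and on the way the
  form of the lowered \<open>q\<close> does not increase.

  The fundamental crystal is the closure of \<open>y_{i,n}\<close> under steps (\<open>fundamental_crystal_eq\<close>). Every
  nontrivial Kashiwara operator is a step. Conversely an element \<open>y_{i,n} z_U^{-1} \<noteq> y_{i,n}\<close> of the closure is
  raised by a Kashiwara operator at the lowest level of \<open>U\<close>, provided that \<open>U \<ge> 0\<close> and that \<open>U\<close> lives on levels
  at most \<open>n - 2\<close>. Both properties hold because the \<open>U_j(k)\<close> are the dimensions of a graded module over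
  the mesh relations whose socle is concentrated at \<open>(i, n - 2)\<close>: the exponent \<open>b_{j,k}\<close> is the Euler
  characteristic of a three-term complex ending at \<open>(j,k)\<close>, so a positive exponent leaves room to
  enlarge the module and a negative one room to shrink it (\<open>step_closure_module\<close>). By duality
  \<open>E_q(p) \<ge> 0\<close> for any two fundamental elements, and by additivity every element of the product crystal is regular.

  Conversely (\<open>regular_set_reachable\<close>) every regular \<open>p\<close> is obtained from \<open>y_R\<close> by lowering steps, by
  induction on the size of \<open>S\<close>. If some exponent is negative, a raising step gives a smaller regular
  datum, which lowers back to \<open>p\<close> when the step is made at the largest \<open>k\<close> with \<open>a_{j,k} < 0\<close>. If all
  exponents are nonnegative, then \<open>p z_{j,k}\<close> is still regular for \<open>(j,k)\<close> in the lowest level of \<open>S\<close>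
  (\<open>firing_bound\<close>), and it lowers back to \<open>p\<close>. The product crystal contains \<open>y_R\<close> and is closed under
  lowering, so it contains every regular datum.
\<close>

section \<open>Pairings of finitely supported integer functions\<close>

abbreviation expo :: "'i monomial \<Rightarrow> 'i \<Rightarrow> int \<Rightarrow> int" where
  "expo p j k \<equiv> Poly_Mapping.lookup p (j, k)"

definition pairing :: "('a \<Rightarrow>\<^sub>0 int) \<Rightarrow> ('a \<Rightarrow> int) \<Rightarrow> int" where
  "pairing f g = (\<Sum>x\<in>Poly_Mapping.keys f. Poly_Mapping.lookup f x * g x)"

lemma pairing_superset:
  assumes "finite X" "Poly_Mapping.keys f \<subseteq> X"
  shows "pairing f g = (\<Sum>x\<in>X. Poly_Mapping.lookup f x * g x)"
  unfolding pairing_def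
  by (rule sum.mono_neutral_left) (use assms in \<open>auto simp: in_keys_iff\<close>)

lemma pairing_zero [simp]: "pairing 0 g = 0"
  by (simp add: pairing_def)

lemma pairing_add: "pairing (f + f') g = pairing f g + pairing f' g"
proof -
  let ?X = "Poly_Mapping.keys f \<union> Poly_Mapping.keys f'"
  have "Poly_Mapping.keys (f + f') \<subseteq> ?X" by (rule keys_add)
  then show ?thesis
    by (simp add: pairing_superset[of ?X] lookup_add sum.distrib distrib_right)
qed

lemma pairing_minus: "pairing (f - f') g = pairing f g - pairing f' g"
  using pairing_add[of "f - f'" f' g] by simp

lemma pairing_frag_of [simp]: "pairing (frag_of x) g = g x"
  by (simp add: pairing_def)

lemma pairing_sum: "pairing (sum f X) g = (\<Sum>x\<in>X. pairing (f x) g)"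
  by (induction X rule: infinite_finite_induct) (auto simp: pairing_add)

lemma pairing_zero_right [simp]: "pairing f (\<lambda>_. 0) = 0"
  by (simp add: pairing_def)

lemma pairing_add_right: "pairing f (\<lambda>x. g x + h x) = pairing f g + pairing f h"
  by (simp add: pairing_def distrib_left sum.distrib)

lemma pairing_minus_right: "pairing f (\<lambda>x. g x - h x) = pairing f g - pairing f h"
  by (simp add: pairing_def right_diff_distrib sum_subtractf)

lemma pairing_nonneg:
  assumes "\<And>x. x \<in> Poly_Mapping.keys f \<Longrightarrow> Poly_Mapping.lookup f x * g x \<ge> 0"
  shows "pairing f g \<ge> 0"
  unfolding pairing_def by (rule sum_nonneg) (use assms in auto)

section \<open>Linear algebra over the field with two elements\<close>

lemma fun_bit_add_self [simp]: "(f :: 'b \<Rightarrow> bit) + f = 0"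
  by (rule ext) (simp add: plus_fun_def)

definition binary_space :: "('b \<Rightarrow> bit) set \<Rightarrow> bool" where
  "binary_space S \<longleftrightarrow> finite S \<and> 0 \<in> S \<and> (\<forall>f\<in>S. \<forall>g\<in>S. f + g \<in> S)"

lemma binary_space_finite: "binary_space S \<Longrightarrow> finite S"
  and binary_space_zero: "binary_space S \<Longrightarrow> 0 \<in> S"
  and binary_space_add: "binary_space S \<Longrightarrow> f \<in> S \<Longrightarrow> g \<in> S \<Longrightarrow> f + g \<in> S"
  by (auto simp: binary_space_def)

lemma binary_space_sum:
  assumes "binary_space S" "\<And>x. x \<in> X \<Longrightarrow> f x \<in> S"
  shows "(\<Sum>x\<in>X. f x) \<in> S"
  using assms(2)
  by (induction X rule: infinite_finite_induct)
    (auto intro: binary_space_zero[OF assms(1)] binary_space_add[OF assms(1)])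

text \<open>
  In characteristic two, adjoining one vector to a subspace adds just one coset. Dimensions are recorded
  by cardinalities: adding one to the dimension doubles the number of elements.
\<close>

lemma binary_space_extend:
  assumes S: "binary_space S" and v: "v \<notin> S"
  shows "binary_space (S \<union> (+) v ` S)" and "card (S \<union> (+) v ` S) = 2 * card S"
proof -
  have shift: "v + (v + f) = f" for f
    by (simp add: add.assoc[symmetric])
  have "f + g \<in> S \<union> (+) v ` S" if "f \<in> S \<union> (+) v ` S" "g \<in> S \<union> (+) v ` S" for f g
  proof -
    from that(1) obtain f' where f': "f' \<in> S" "f = f' \<or> f = v + f'" by auto
    from that(2) obtain g' where g': "g' \<in> S" "g = g' \<or> g = v + g'" by auto
    have mem: "f' + g' \<in> S" using S f'(1) g'(1) by (rule binary_space_add)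
    have "f + g = f' + g' \<or> f + g = v + (f' + g')"
      using f'(2) g'(2) shift by (metis add.assoc add.commute)
    with mem show ?thesis by auto
  qed
  then show "binary_space (S \<union> (+) v ` S)"
    using S by (auto simp: binary_space_def)
  have "S \<inter> (+) v ` S = {}"
  proof (rule ccontr)
    assume "\<not> ?thesis"
    then obtain f where "f \<in> S" "v + f \<in> S" by auto
    then have "(v + f) + f \<in> S" using S by (blast intro: binary_space_add)
    then show False using v by (simp add: add.assoc)
  qed
  moreover have "inj_on ((+) v) S" by (rule inj_onI) (metis shift)
  ultimately show "card (S \<union> (+) v ` S) = 2 * card S"
    using binary_space_finite[OF S] by (simp add: card_Un_disjoint card_image)
qed

text \<open>
  The rank-nullity theorem in multiplicative form: all nonempty fibres are cosets of the kernel.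
\<close>

lemma card_kernel_image:
  assumes D: "binary_space D" and add: "\<And>f g. \<mu> (f + g) = \<mu> f + (\<mu> g :: 'c \<Rightarrow> bit)"
  shows "card D = card (\<mu> ` D) * card {f \<in> D. \<mu> f = 0}"
proof -
  have fib: "card {f \<in> D. \<mu> f = y} = card {f \<in> D. \<mu> f = 0}" if "y \<in> \<mu> ` D" for y
  proof -
    from that obtain g where g: "g \<in> D" "y = \<mu> g" by auto
    have shift: "g + (g + f) = f" for f by (simp add: add.assoc[symmetric])
    have "bij_betw ((+) g) {f \<in> D. \<mu> f = y} {f \<in> D. \<mu> f = 0}"
      by (rule bij_betw_byWitness[where f' = "(+) g"])
        (use g shift binary_space_add[OF D] in \<open>auto simp: add\<close>)
    then show ?thesis by (rule bij_betw_same_card)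
  qed
  have "card D = card (\<Union>y\<in>\<mu> ` D. {f \<in> D. \<mu> f = y})"
    by (rule arg_cong[where f = card]) auto
  also have "\<dots> = (\<Sum>y\<in>\<mu> ` D. card {f \<in> D. \<mu> f = y})"
    by (rule card_UN_disjoint) (use binary_space_finite[OF D] in auto)
  also have "\<dots> = card (\<mu> ` D) * card {f \<in> D. \<mu> f = 0}"
    using fib by simp
  finally show ?thesis .
qed

text \<open>
  A subspace that is maximal among the proper subspaces containing \<open>W\<close> has index two, because
  adjoining any further vector already gives everything.
\<close>

lemma binary_space_hyperplane:
  assumes V: "binary_space V" and W: "binary_space W" "W \<subset> V"
  obtains X where "binary_space X" "W \<subseteq> X" "X \<subset> V" "card V = 2 * card X"
proof -
  let ?C = "{X. binary_space X \<and> W \<subseteq> X \<and> X \<subset> V}"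
  have "finite ?C"
    by (rule finite_subset[of _ "Pow V"]) (use binary_space_finite[OF V] in auto)
  moreover have "?C \<noteq> {}" using W by blast
  ultimately obtain X where X: "X \<in> ?C" and max: "\<And>Y. Y \<in> ?C \<Longrightarrow> X \<subseteq> Y \<Longrightarrow> X = Y"
    by (metis (no_types, lifting) finite_has_maximal)
  then obtain v where v: "v \<in> V" "v \<notin> X" by blast
  let ?Y = "X \<union> (+) v ` X"
  have Y: "binary_space ?Y" "card ?Y = 2 * card X"
    using binary_space_extend X v by blast+
  have "?Y \<subseteq> V" using X v binary_space_add[OF V] by blast
  moreover have "v \<in> ?Y"
  proof -
    have "v + 0 \<in> (+) v ` X" using binary_space_zero X by blast
    then show ?thesis by simp
  qed
  ultimately have "?Y = V" using max[of ?Y] Y X v by blast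
  then show ?thesis using that X Y by auto
qed

lemma UNIV_bit: "(UNIV :: bit set) = {0, 1}"
  by (auto intro: bit.exhaust)

section \<open>Modules over the mesh relations\<close>

text \<open>
  A vector at \<open>(j, k)\<close> is a function on the walks that start at \<open>j\<close>; the list records the vertices after
  \<open>j\<close>. The arrow towards a neighbour \<open>l\<close> restricts to the walks through \<open>l\<close> first and raises the level by
  one. A vector is determined by its images under all arrows and by its value at the empty walk.
\<close>

definition arrow :: "'b \<Rightarrow> ('b list \<Rightarrow> bit) \<Rightarrow> 'b list \<Rightarrow> bit" where
  "arrow l f = (\<lambda>w. f (l # w))"

lemma arrow_zero [simp]: "arrow l 0 = 0"
  by (simp add: arrow_def zero_fun_def)

lemma arrow_add: "arrow l (f + g) = arrow l f + arrow l g"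
  by (simp add: arrow_def plus_fun_def)

lemma arrow_determines:
  assumes "f [] = g []" "\<And>l. arrow l f = arrow l g"
  shows "f = g"
proof (rule ext)
  fix w show "f w = g w"
    using assms(1) assms(2)[THEN fun_cong] by (cases w) (auto simp: arrow_def)
qed

text \<open>
  Composition \<open>(j, k) \<rightarrow> (l, k + 1) \<rightarrow> (j, k + 2)\<close>, summed over the neighbours \<open>l\<close>. Its vanishing is the
  preprojective relation at \<open>j\<close>.
\<close>

definition mesh :: "('i::finite \<Rightarrow> 'i \<Rightarrow> int) \<Rightarrow> 'i \<Rightarrow> ('i list \<Rightarrow> bit) \<Rightarrow> 'i list \<Rightarrow> bit" where
  "mesh A j f = (\<Sum>l | adj A j l. arrow j (arrow l f))"

lemma mesh_add: "mesh A j (f + g) = mesh A j f + mesh A j g"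
  by (simp add: mesh_def arrow_add sum.distrib)

text \<open>
  The largest space that can sit at \<open>(j, k)\<close> below the given spaces at level \<open>k + 1\<close>: the direct sum of
  the neighbouring \<open>V l (k + 1)\<close>, together with one framing coordinate (the value at the empty walk) at
  \<open>(i, n - 2)\<close>.
\<close>

definition framed_space ::
  "('i::finite \<Rightarrow> 'i \<Rightarrow> int) \<Rightarrow> 'i \<Rightarrow> int \<Rightarrow> ('i \<Rightarrow> int \<Rightarrow> ('i list \<Rightarrow> bit) set) \<Rightarrow> 'i \<Rightarrow> int \<Rightarrow>
     ('i list \<Rightarrow> bit) set" where
  "framed_space A i n V j k =
     {f. (f [] \<noteq> 0 \<longrightarrow> j = i \<and> k = n - 2) \<and>
         (\<forall>l. arrow l f \<in> (if adj A j l then V l (k + 1) else {0}))}"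

text \<open>
  These are the submodules of the injective hull of the simple module at \<open>(i, n - 2)\<close> for the mesh
  relations, graded by level. Equivalently they are the stable points of the graded quiver varieties
  whose framing is one-dimensional at \<open>(i, n)\<close>. At each \<open>(j, k)\<close> they give a complex
  \<open>V j k \<subseteq> framed_space j k \<rightarrow> V j (k + 2)\<close> whose second map is \<open>mesh\<close>. Its Euler characteristic is taken
  with the middle term counted positively.
\<close>

definition framed_module ::
  "('i::finite \<Rightarrow> 'i \<Rightarrow> int) \<Rightarrow> 'i \<Rightarrow> int \<Rightarrow> ('i \<Rightarrow> int \<Rightarrow> ('i list \<Rightarrow> bit) set) \<Rightarrow> bool" where
  "framed_module A i n V \<longleftrightarrow>
     (\<forall>j k. binary_space (V j k) \<and> V j k \<subseteq> {f \<in> framed_space A i n V j k. mesh A j f = 0} \<and>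
       (k > n - 2 \<longrightarrow> V j k = {0}))"

lemma framed_moduleD:
  assumes "framed_module A i n V"
  shows "binary_space (V j k)" "V j k \<subseteq> framed_space A i n V j k"
    "f \<in> V j k \<Longrightarrow> mesh A j f = 0" "k > n - 2 \<Longrightarrow> V j k = {0}"
  using assms unfolding framed_module_def by blast+

lemma framed_spaceD:
  assumes "f \<in> framed_space A i n V j k"
  shows "adj A j l \<Longrightarrow> arrow l f \<in> V l (k + 1)" "\<not> adj A j l \<Longrightarrow> arrow l f = 0"
proof -
  have "arrow l f \<in> (if adj A j l then V l (k + 1) else {0})"
    using assms unfolding framed_space_def by blast
  then show "adj A j l \<Longrightarrow> arrow l f \<in> V l (k + 1)" "\<not> adj A j l \<Longrightarrow> arrow l f = 0"
    by auto
qed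

lemma framed_space_mono:
  "(\<And>l m. V l m \<subseteq> W l m) \<Longrightarrow> framed_space A i n V j k \<subseteq> framed_space A i n W j k"
  unfolding framed_space_def by (auto split: if_splits)

lemma card_framed_space:
  assumes "\<And>l m. finite (V l m)" "\<And>l m. card (V l m) = 2 ^ d l m"
  shows "card (framed_space A i n V j k) =
           2 ^ ((if j = i \<and> k = n - 2 then 1 else 0) + (\<Sum>l | adj A j l. d l (k + 1)))"
    and "finite (framed_space A i n V j k)"
proof -
  let ?c = "if j = i \<and> k = n - 2 then UNIV else {0 :: bit}"
  let ?V = "\<lambda>l. if adj A j l then V l (k + 1) else {0}"
  let ?to = "\<lambda>f. (f [], \<lambda>l. arrow l f)"
  let ?from = "\<lambda>(c, g). \<lambda>w. case w of [] \<Rightarrow> c | l # w' \<Rightarrow> g l w'"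
  have bij: "bij_betw ?to (framed_space A i n V j k) (?c \<times> Pi\<^sub>E UNIV ?V)"
    by (rule bij_betw_byWitness[where f' = ?from])
      (auto simp: framed_space_def arrow_def fun_eq_iff PiE_def Pi_def split: list.splits if_splits)
  have fin: "finite (?c \<times> Pi\<^sub>E UNIV ?V)"
    by (intro finite_cartesian_product finite_PiE) (use assms(1) in \<open>auto simp: UNIV_bit\<close>)
  with bij show "finite (framed_space A i n V j k)" by (simp add: bij_betw_finite)
  have "card (framed_space A i n V j k) = card ?c * (\<Prod>l\<in>UNIV. card (?V l))"
    using bij_betw_same_card[OF bij] by (simp add: card_cartesian_product card_PiE)
  also have "(\<Prod>l\<in>UNIV. card (?V l)) = (\<Prod>l\<in>UNIV. if adj A j l then 2 ^ d l (k + 1) else 1)"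
    by (intro prod.cong) (auto simp: assms(2))
  also have "\<dots> = (\<Prod>l | adj A j l. 2 ^ d l (k + 1))"
    by (simp add: prod.If_cases)
  also have "\<dots> = 2 ^ (\<Sum>l | adj A j l. d l (k + 1))"
    by (simp add: power_sum)
  also have "card ?c = 2 ^ (if j = i \<and> k = n - 2 then 1 else 0)"
    by (auto simp: UNIV_bit)
  finally show "card (framed_space A i n V j k) =
           2 ^ ((if j = i \<and> k = n - 2 then 1 else 0) + (\<Sum>l | adj A j l. d l (k + 1)))"
    by (simp add: power_add)
qed

context
  fixes A :: "'i::finite \<Rightarrow> 'i \<Rightarrow> int" and i :: 'i and n :: int and V
  assumes V: "framed_module A i n V"
begin

lemma framed_space_add:
  assumes f: "f \<in> framed_space A i n V j k" and g: "g \<in> framed_space A i n V j k"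
  shows "f + g \<in> framed_space A i n V j k"
proof -
  have "arrow l (f + g) \<in> (if adj A j l then V l (k + 1) else {0})" for l
  proof (cases "adj A j l")
    case True
    then have "arrow l f \<in> V l (k + 1)" "arrow l g \<in> V l (k + 1)"
      using f g framed_spaceD(1) by blast+
    with True show ?thesis
      using binary_space_add[OF framed_moduleD(1)[OF V]] by (simp add: arrow_add)
  next
    case False
    then have "arrow l f = 0" "arrow l g = 0"
      using f g framed_spaceD(2) by blast+
    with False show ?thesis by (simp add: arrow_add)
  qed
  moreover have "j = i \<and> k = n - 2" if "(f + g) [] \<noteq> 0"
  proof -
    from that have "f [] \<noteq> 0 \<or> g [] \<noteq> 0" by (auto simp: plus_fun_def)
    then show ?thesis using f g unfolding framed_space_def by blast
  qed
  ultimately show ?thesis unfolding framed_space_def by blast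
qed

lemma framed_space_binary:
  assumes "\<And>l m. card (V l m) = 2 ^ d l m"
  shows "binary_space (framed_space A i n V j k)"
proof -
  have "finite (framed_space A i n V j k)"
    by (rule card_framed_space(2)[of V d])
      (use assms binary_space_finite[OF framed_moduleD(1)[OF V]] in auto)
  moreover have "0 \<in> framed_space A i n V j k"
    using binary_space_zero[OF framed_moduleD(1)[OF V]] by (auto simp: framed_space_def)
  ultimately show ?thesis
    unfolding binary_space_def using framed_space_add by blast
qed

lemma mesh_framed_space:
  assumes "f \<in> framed_space A i n V j k"
  shows "mesh A j f \<in> V j (k + 2)"
  unfolding mesh_def
proof (rule binary_space_sum[OF framed_moduleD(1)[OF V]])
  fix l assume "l \<in> {l. adj A j l}"
  then have "arrow l f \<in> V l (k + 1)" "adj A j l"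
    using assms by (auto simp: framed_space_def split: if_splits)
  then have "arrow l f \<in> framed_space A i n V l (k + 1)" using framed_moduleD(2)[OF V] by blast
  then have *: "arrow j (arrow l f) \<in> (if adj A l j then V j (k + 1 + 1) else {0})"
    unfolding framed_space_def by blast
  show "arrow j (arrow l f) \<in> V j (k + 2)"
    using * binary_space_zero[OF framed_moduleD(1)[OF V], of j "k + 2"]
    by (auto simp: add.assoc split: if_splits)
qed

text \<open>
  Any kernel element of the mesh map may be adjoined: enlarging \<open>V j k\<close> only relaxes the conditions on the
  spaces one level below.
\<close>

lemma framed_module_lower:
  assumes f: "f \<in> framed_space A i n V j k" "mesh A j f = 0" "f \<notin> V j k"
  shows "framed_module A i n (V(j := (V j)(k := V j k \<union> (+) f ` V j k)))" (is "framed_module A i n ?W")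
proof -
  have mono: "V l m \<subseteq> ?W l m" for l m by auto
  have k: "k \<le> n - 2"
  proof (rule ccontr)
    assume k: "\<not> k \<le> n - 2"
    then have "arrow l f = arrow l 0" for l
      using f(1) framed_moduleD(4)[OF V, of "k + 1" l] by (auto simp: framed_space_def split: if_splits)
    moreover have "f [] = 0 []" using f(1) k by (auto simp: framed_space_def)
    ultimately have "f = 0" using arrow_determines[of f 0] by blast
    then show False using f(3) binary_space_zero[OF framed_moduleD(1)[OF V]] by blast
  qed
  have sub: "?W l m \<subseteq> {g \<in> framed_space A i n V l m. mesh A l g = 0}" for l m
  proof -
    have 1: "V l m \<subseteq> {g \<in> framed_space A i n V l m. mesh A l g = 0}" for l m
      using framed_moduleD(2,3)[OF V] by blast
    have "f + g \<in> {g \<in> framed_space A i n V j k. mesh A j g = 0}" if "g \<in> V j k" for g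
      using that 1[of j k] f framed_space_add by (auto simp: mesh_add)
    with 1 show ?thesis by auto
  qed
  show ?thesis
    unfolding framed_module_def
  proof (intro allI conjI impI)
    fix l m
    show "binary_space (?W l m)"
      by (cases "l = j \<and> m = k")
        (simp_all add: binary_space_extend(1)[OF framed_moduleD(1)[OF V] f(3)] framed_moduleD(1)[OF V])
    show "?W l m \<subseteq> {g \<in> framed_space A i n ?W l m. mesh A l g = 0}"
    proof -
      have "framed_space A i n V l m \<subseteq> framed_space A i n ?W l m"
        by (rule framed_space_mono) (rule mono)
      with sub[of l m] show ?thesis by blast
    qed
    assume "m > n - 2"
    with k have "?W l m = V l m" by auto
    with \<open>m > n - 2\<close> show "?W l m = {0}" using framed_moduleD(4)[OF V] by simp
  qed
qed

text \<open>
  A subspace of \<open>V j k\<close> may replace it as soon as it still receives everything that comes from level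
  \<open>k - 1\<close>. Since every vector of a neighbouring \<open>V l (k - 1)\<close> is a component of the framed space at
  \<open>(j, k - 2)\<close>, this is the condition that it contains the image of the mesh map.
\<close>

lemma framed_module_raise:
  assumes X: "binary_space X" "mesh A j ` framed_space A i n V j (k - 2) \<subseteq> X" "X \<subset> V j k"
    and sym: "\<And>l. adj A l j \<longleftrightarrow> adj A j l"
  shows "framed_module A i n (V(j := (V j)(k := X)))" (is "framed_module A i n ?W")
proof -
  have k: "k \<le> n - 2"
    using X framed_moduleD(4)[OF V, of k j] binary_space_zero[OF X(1)] by force
  have arr: "arrow j f \<in> X" if "f \<in> V l (k - 1)" "adj A l j" for f l
  proof -
    define g where "g = (\<lambda>w. case w of [] \<Rightarrow> 0 | m # w' \<Rightarrow> if m = l then f w' else 0)"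
    have g: "arrow m g = (if m = l then f else 0)" for m
      by (auto simp: arrow_def g_def)
    have "g \<in> framed_space A i n V j (k - 2)"
      using that sym binary_space_zero[OF framed_moduleD(1)[OF V]]
      by (auto simp: framed_space_def g) (simp_all add: g_def)
    moreover have "mesh A j g = arrow j f"
    proof -
      have "mesh A j g = (\<Sum>m | adj A j m. if m = l then arrow j f else 0)"
        unfolding mesh_def g by (intro sum.cong) auto
      also have "\<dots> = arrow j f" using that(2) sym by (subst sum.delta) auto
      finally show ?thesis .
    qed
    ultimately show ?thesis using X(2) by force
  qed
  show ?thesis
    unfolding framed_module_def
  proof (intro allI conjI impI)
    fix l m
    show "binary_space (?W l m)"
      by (cases "l = j \<and> m = k") (simp_all add: X(1) framed_moduleD(1)[OF V])
    have sub: "?W l m \<subseteq> V l m" using X(3) by auto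
    show "?W l m \<subseteq> {g \<in> framed_space A i n ?W l m. mesh A l g = 0}"
    proof
      fix f assume "f \<in> ?W l m"
      with sub have f: "f \<in> V l m" by blast
      then have fr: "f \<in> framed_space A i n V l m" using framed_moduleD(2)[OF V] by blast
      have "arrow l' f \<in> (if adj A l l' then ?W l' (m + 1) else {0})" for l'
      proof -
        have "arrow l' f \<in> (if adj A l l' then V l' (m + 1) else {0})"
          using fr unfolding framed_space_def by blast
        moreover have "arrow j f \<in> X" if "adj A l j" "m + 1 = k"
        proof -
          from that(2) have "m = k - 1" by simp
          with f have "f \<in> V l (k - 1)" by simp
          then show ?thesis using that(1) by (rule arr)
        qed
        ultimately show ?thesis by auto
      qed
      then show "f \<in> {g \<in> framed_space A i n ?W l m. mesh A l g = 0}"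
        using fr framed_moduleD(3)[OF V f] unfolding framed_space_def by blast
    qed
    assume "m > n - 2"
    with k have "?W l m = V l m" by auto
    with \<open>m > n - 2\<close> show "?W l m = {0}" using framed_moduleD(4)[OF V] by simp
  qed
qed

end

definition module_dims where
  "module_dims A i n d \<longleftrightarrow> (\<exists>V. framed_module A i n V \<and> (\<forall>j k. card (V j k) = 2 ^ d j k))"

lemma module_dims_zero: "module_dims A i n (\<lambda>_ _. 0)"
  unfolding module_dims_def
proof (intro exI conjI allI)
  show "framed_module A i n (\<lambda>_ _. {0})"
    unfolding framed_module_def
    by (auto simp: binary_space_def framed_space_def mesh_def)
qed simp

text \<open>
  The hypothesis says that the Euler characteristic of the complex at \<open>(j, k)\<close> is positive. Then the kernel
  of the mesh map is strictly larger than \<open>V j k\<close>.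
\<close>

lemma module_dims_lower:
  assumes d: "module_dims A i n d"
    and gt: "d j k + d j (k + 2) < (if j = i \<and> k = n - 2 then 1 else 0) + (\<Sum>l | adj A j l. d l (k + 1))"
  shows "module_dims A i n (d(j := (d j)(k := d j k + 1)))"
proof -
  obtain V where V: "framed_module A i n V" and card: "\<And>j k. card (V j k) = 2 ^ d j k"
    using d unfolding module_dims_def by blast
  let ?D = "framed_space A i n V j k"
  let ?K = "{f \<in> ?D. mesh A j f = 0}"
  have fin: "finite (V l m)" for l m
    by (rule binary_space_finite[OF framed_moduleD(1)[OF V]])
  have "card (mesh A j ` ?D) \<le> card (V j (k + 2))"
    using mesh_framed_space[OF V] by (intro card_mono fin) auto
  moreover have "card ?D = card (mesh A j ` ?D) * card ?K"
    by (rule card_kernel_image[OF framed_space_binary[OF V card] mesh_add])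
  ultimately have "card ?D \<le> card (V j (k + 2)) * card ?K" by simp
  moreover have "card (V j (k + 2)) * card (V j k) < card ?D"
  proof -
    have "card (V j (k + 2)) * card (V j k) = 2 ^ (d j k + d j (k + 2))"
      by (simp add: card power_add)
    also have "\<dots> < (2 :: nat) ^ ((if j = i \<and> k = n - 2 then 1 else 0) + (\<Sum>l | adj A j l. d l (k + 1)))"
      using gt by (intro power_strict_increasing) auto
    finally show ?thesis by (simp only: card_framed_space(1)[of V d, OF fin card])
  qed
  ultimately have "card (V j (k + 2)) * card (V j k) < card (V j (k + 2)) * card ?K"
    by linarith
  then have "card (V j k) < card ?K" by simp
  then have "\<not> ?K \<subseteq> V j k" using card_mono[OF fin] by (meson linorder_not_le)
  then obtain f where f: "f \<in> ?D" "mesh A j f = 0" "f \<notin> V j k" by blast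
  show ?thesis
    unfolding module_dims_def
  proof (intro exI conjI allI)
    show "framed_module A i n (V(j := (V j)(k := V j k \<union> (+) f ` V j k)))"
      using framed_module_lower[OF V f] .
    show "card ((V(j := (V j)(k := V j k \<union> (+) f ` V j k))) l m) = 2 ^ (d(j := (d j)(k := d j k + 1))) l m" for l m
      by (cases "l = j \<and> m = k")
        (auto simp: card binary_space_extend(2)[OF framed_moduleD(1)[OF V] f(3)])
  qed
qed

text \<open>
  The hypothesis says that the Euler characteristic of the complex at \<open>(j, k - 2)\<close> is negative. Then the
  mesh map is not onto \<open>V j k\<close>, and \<open>V j k\<close> can be replaced by a hyperplane that contains the image.
\<close>

lemma module_dims_raise:
  assumes d: "module_dims A i n d"
    and less: "(if j = i \<and> k = n then 1 else 0) + (\<Sum>l | adj A j l. d l (k - 1)) < d j k + d j (k - 2)"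
    and sym: "\<And>l. adj A l j \<longleftrightarrow> adj A j l"
  shows "d j k > 0" "module_dims A i n (d(j := (d j)(k := d j k - 1)))"
proof -
  obtain V where V: "framed_module A i n V" and card: "\<And>j k. card (V j k) = 2 ^ d j k"
    using d unfolding module_dims_def by blast
  let ?D = "framed_space A i n V j (k - 2)"
  let ?K = "{f \<in> ?D. mesh A j f = 0}"
  have fin: "finite (V l m)" for l m
    by (rule binary_space_finite[OF framed_moduleD(1)[OF V]])
  have D: "binary_space ?D" by (rule framed_space_binary[OF V card])
  have im: "mesh A j ` ?D \<subseteq> V j k"
    using mesh_framed_space[OF V, of _ j "k - 2"] by auto
  have "card (V j (k - 2)) \<le> card ?K"
    using framed_moduleD(2,3)[OF V] by (intro card_mono) (auto simp: binary_space_finite[OF D])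
  moreover have "card ?D = card (mesh A j ` ?D) * card ?K"
    by (rule card_kernel_image[OF D mesh_add])
  ultimately have "card (mesh A j ` ?D) * card (V j (k - 2)) \<le> card ?D" by simp
  moreover have "card ?D < card (V j k) * card (V j (k - 2))"
  proof -
    have "card ?D = 2 ^ ((if j = i \<and> k - 2 = n - 2 then 1 else 0) + (\<Sum>l | adj A j l. d l (k - 2 + 1)))"
      by (rule card_framed_space(1)[of V d, OF fin card])
    also have "\<dots> < (2 :: nat) ^ (d j k + d j (k - 2))"
      using less by (intro power_strict_increasing) auto
    finally show ?thesis by (simp add: card power_add)
  qed
  ultimately have "card (mesh A j ` ?D) * card (V j (k - 2)) < card (V j k) * card (V j (k - 2))"
    by linarith
  then have "card (mesh A j ` ?D) < card (V j k)" by simp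
  then have W: "mesh A j ` ?D \<subset> V j k" using im by auto
  have "mesh A j 0 = 0" by (simp add: mesh_def)
  moreover have "0 \<in> ?D" using binary_space_zero[OF D] .
  ultimately have "0 \<in> mesh A j ` ?D" by (metis imageI)
  moreover have "f + g \<in> mesh A j ` ?D" if "f \<in> mesh A j ` ?D" "g \<in> mesh A j ` ?D" for f g
    using that binary_space_add[OF D] by (auto simp: mesh_add[symmetric])
  ultimately have "binary_space (mesh A j ` ?D)"
    using binary_space_finite[OF D] unfolding binary_space_def by blast
  then obtain X where X: "binary_space X" "mesh A j ` ?D \<subseteq> X" "X \<subset> V j k" "card (V j k) = 2 * card X"
    using binary_space_hyperplane[OF framed_moduleD(1)[OF V] _ W] by metis
  show pos: "d j k > 0"
  proof (rule ccontr)
    assume "\<not> d j k > 0"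
    then have "2 * card X = 1" using X(4) card[of j k] by simp
    then show False by presburger
  qed
  then have "2 * card X = 2 * 2 ^ (d j k - 1)"
    using X(4) card[of j k] by (metis Suc_diff_1 power_Suc)
  then have cX: "card X = 2 ^ (d j k - 1)" by simp
  show "module_dims A i n (d(j := (d j)(k := d j k - 1)))"
    unfolding module_dims_def
  proof (intro exI conjI allI)
    show "framed_module A i n (V(j := (V j)(k := X)))"
      using framed_module_raise[OF V X(1-3) sym] .
    show "card ((V(j := (V j)(k := X))) l m) = 2 ^ (d(j := (d j)(k := d j k - 1))) l m" for l m
      by (cases "l = j \<and> m = k") (auto simp: card cX)
  qed
qed

lemma module_dims_top: "module_dims A i n d \<Longrightarrow> k > n - 2 \<Longrightarrow> d j k = 0"
proof -
  assume "module_dims A i n d" "k > n - 2"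
  then obtain V where "framed_module A i n V" and "card (V j k) = 2 ^ d j k"
    unfolding module_dims_def by blast
  with \<open>k > n - 2\<close> have "2 ^ d j k = (1::nat)" using framed_moduleD(4)[of A i n V k j] by simp
  then show ?thesis by simp
qed

section \<open>The bilinear form\<close>

text \<open>
  Collections of multisets are treated as finitely supported functions, so that the exponent of \<open>z_{j,k}\<close>
  may a priori be negative. This is the additive extension of \<open>z_{j,k}\<close> to such functions.
\<close>

definition z_lin :: "('i::finite \<Rightarrow> 'i \<Rightarrow> int) \<Rightarrow> 'i monomial \<Rightarrow> 'i monomial" where
  "z_lin A = frag_extend (\<lambda>(j, k). z_mon A j k)"

lemma y_mon_eq_frag_of: "y_mon j k = frag_of (j, k)"
  by (simp add: y_mon_def)

lemma z_lin_zero [simp]: "z_lin A 0 = 0"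
  by (simp add: z_lin_def)

lemma z_lin_add: "z_lin A (U + V) = z_lin A U + z_lin A V"
  by (simp add: z_lin_def frag_extend_add)

lemma z_lin_minus: "z_lin A (U - V) = z_lin A U - z_lin A V"
  by (simp add: z_lin_def frag_extend_diff)

lemma z_lin_frag_of [simp]: "z_lin A (frag_of (j, k)) = z_mon A j k"
  by (simp add: z_lin_def)

lemma lookup_frag_of': "expo (frag_of (j, k)) j' k' = (if j = j' \<and> k = k' then 1 else 0)"
  by (auto simp: lookup_frag_of)

lemma lookup_z_lin:
  "expo (z_lin A U) j k = expo U j k + expo U j (k - 2) - (\<Sum>l | adj A j l. expo U l (k - 1))"
  using subset_UNIV[of "Poly_Mapping.keys U"]
proof (induction U rule: frag_induction)
  case zero
  show ?case by simp
next
  case (one x)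
  obtain i m where x: "x = (i, m)" by force
  have *: "(\<Sum>l | adj A j l. expo (frag_of (i, m)) l (k - 1)) = (if adj A j i \<and> m = k - 1 then 1 else 0)"
  proof -
    have "(\<Sum>l | adj A j l. expo (frag_of (i, m)) l (k - 1)) =
        (\<Sum>l | adj A j l. if l = i then (if m = k - 1 then 1 else 0) else 0)"
      by (intro sum.cong) (auto simp: lookup_frag_of')
    also have "\<dots> = (if adj A j i \<and> m = k - 1 then 1 else 0)"
      by (subst sum.delta) auto
    finally show ?thesis .
  qed
  show ?case
    unfolding x z_lin_frag_of lookup_z_mon *
    by (simp add: lookup_frag_of' del: lookup_frag_of)
next
  case (diff a b)
  then show ?case by (simp add: z_lin_minus lookup_minus sum_subtractf)
qed

text \<open>
  \<open>E_q(p)\<close> for \<open>q = y_T z_U^{-1}\<close> and \<open>p = y_R z_S^{-1}\<close>. It is the alternating sum of the dimensions in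
  Nakajima's three-term complex for two points of graded quiver varieties.
\<close>

definition nakajima_form ::
  "('i::finite \<Rightarrow> 'i \<Rightarrow> int) \<Rightarrow> 'i monomial \<Rightarrow> 'i monomial \<Rightarrow> 'i monomial \<Rightarrow> 'i monomial \<Rightarrow> int" where
  "nakajima_form A T U R S =
     pairing U (\<lambda>(j, k). expo R j (k + 1)) + pairing (T - z_lin A U) (\<lambda>(j, k). expo S j (k - 1))"

locale bipartite_diagram =
  fixes A :: "'i::finite \<Rightarrow> 'i \<Rightarrow> int" and I1 :: "'i set"
  assumes adj_sym: "adj A i j \<longleftrightarrow> adj A j i"
    and bipartite: "parity_partition A I1"
begin

text \<open>
  The operator \<open>z_lin\<close> is self-adjoint up to a shift of levels, since adjacency is symmetric. This is what
  makes the form symmetric.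
\<close>

lemma pairing_z_lin:
  "pairing (z_lin A U) (\<lambda>(j, k). expo S j (k - 1)) = pairing U (\<lambda>(j, k). expo (z_lin A S) j (k + 1))"
  using subset_UNIV[of "Poly_Mapping.keys U"]
proof (induction U rule: frag_induction)
  case zero
  show ?case by simp
next
  case (one x)
  obtain i m where x: "x = (i, m)" by force
  have "{j. adj A j i} = {j. adj A i j}" using adj_sym by blast
  then show ?case
    by (simp add: x z_mon_def pairing_add pairing_minus pairing_sum y_mon_eq_frag_of lookup_z_lin add.commute)
next
  case (diff a b)
  then show ?case by (simp add: z_lin_minus pairing_minus)
qed

lemma nakajima_form_alt:
  "nakajima_form A T U R S =
     pairing T (\<lambda>(j, k). expo S j (k - 1)) + pairing U (\<lambda>(j, k). expo (R - z_lin A S) j (k + 1))"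
  unfolding nakajima_form_def pairing_minus pairing_z_lin lookup_minus
  by (simp add: case_prod_unfold pairing_minus_right)

lemma nakajima_form_add_left:
  "nakajima_form A T (U + frag_of (j, k)) R S = nakajima_form A T U R S + expo (R - z_lin A S) j (k + 1)"
  by (simp add: nakajima_form_alt pairing_add)

lemma nakajima_form_minus_left:
  "nakajima_form A T (U - frag_of (j, k)) R S = nakajima_form A T U R S - expo (R - z_lin A S) j (k + 1)"
  by (simp add: nakajima_form_alt pairing_minus)

lemma pairing_shift:
  "pairing T (\<lambda>(j, k). expo S j (k - 1)) = pairing S (\<lambda>(j, k). expo T j (k + 1))"
  using subset_UNIV[of "Poly_Mapping.keys S"]
proof (induction S rule: frag_induction)
  case zero
  show ?case by (simp add: case_prod_unfold)
next
  case (one x)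
  obtain i m where x: "x = (i, m)" by force
  have "pairing T (\<lambda>(j, k). expo (frag_of x) j (k - 1)) =
      (\<Sum>y\<in>Poly_Mapping.keys T. if y = (i, m + 1) then Poly_Mapping.lookup T y else 0)"
    unfolding pairing_def by (intro sum.cong) (auto simp: x lookup_frag_of split: if_splits)
  also have "\<dots> = expo T i (m + 1)"
    by (simp add: sum.delta in_keys_iff)
  finally show ?case by (simp add: x)
next
  case (diff a b)
  then show ?case by (simp add: lookup_minus case_prod_unfold pairing_minus pairing_minus_right)
qed

lemma nakajima_form_sym: "nakajima_form A T U R S = nakajima_form A R S T U"
  by (subst nakajima_form_alt) (simp add: nakajima_form_def pairing_shift)

lemma nakajima_form_add_right:
  "nakajima_form A T U R (S + frag_of (j, k)) = nakajima_form A T U R S + expo (T - z_lin A U) j (k + 1)"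
  using nakajima_form_add_left nakajima_form_sym by simp

lemma nakajima_form_minus_right:
  "nakajima_form A T U R (S - frag_of (j, k)) = nakajima_form A T U R S - expo (T - z_lin A U) j (k + 1)"
  using nakajima_form_minus_left nakajima_form_sym by simp

section \<open>Steps and duality\<close>

text \<open>
  The set \<open>P\<close> consists of the exponents \<open>U\<close> of the monomials \<open>y_T z_U^{-1}\<close>.
\<close>

definition step_closed :: "'i monomial \<Rightarrow> 'i monomial set \<Rightarrow> bool" where
  "step_closed T P \<longleftrightarrow> (\<forall>U\<in>P. \<forall>j k.
     (expo (T - z_lin A U) j (k + 2) > 0 \<longrightarrow> U + frag_of (j, k) \<in> P) \<and>
     (expo (T - z_lin A U) j k < 0 \<longrightarrow> U - frag_of (j, k) \<in> P))"

lemma step_closed_lower: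
  "step_closed T P \<Longrightarrow> U \<in> P \<Longrightarrow> expo (T - z_lin A U) j (k + 2) > 0 \<Longrightarrow> U + frag_of (j, k) \<in> P"
  by (simp add: step_closed_def)

lemma step_closed_raise:
  "step_closed T P \<Longrightarrow> U \<in> P \<Longrightarrow> expo (T - z_lin A U) j k < 0 \<Longrightarrow> U - frag_of (j, k) \<in> P"
  by (simp add: step_closed_def)

lemma lookup_z_mon_self: "expo (z_mon A j k) j k = 1" "expo (z_mon A j k) j (k + 2) = 1"
  by (simp_all add: lookup_z_mon adj_def)

text \<open>
  If lowering the left argument makes the form smaller, then the right argument has a negative exponent
  at \<open>(j, k + 1)\<close> and can be raised there. The form of the lowered left argument does not increase under
  this, because its own exponent at \<open>(j, k + 2)\<close> is still nonnegative. After finitely many raising steps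
  the exponent at \<open>(j, k + 1)\<close> is zero, and then lowering the left argument does not change the form.
\<close>

lemma nakajima_form_lower_step:
  assumes P: "step_closed R P" and pos: "\<And>S. S \<in> P \<Longrightarrow> nakajima_form A T U R S \<ge> 0"
    and U: "expo (T - z_lin A U) j (k + 2) > 0"
  shows "S \<in> P \<Longrightarrow> nakajima_form A T (U + frag_of (j, k)) R S \<ge> 0"
proof (induction "nat (- expo (R - z_lin A S) j (k + 1))" arbitrary: S)
  case 0
  then show ?case using pos[of S] by (simp add: nakajima_form_add_left)
next
  case (Suc n)
  let ?S = "S - frag_of (j, k + 1)"
  have neg: "expo (R - z_lin A S) j (k + 1) < 0" using Suc by linarith
  then have "?S \<in> P" using step_closed_raise[OF P] Suc by blast
  moreover have "n = nat (- expo (R - z_lin A ?S) j (k + 1))"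
    using Suc(2) by (simp add: z_lin_minus lookup_minus lookup_z_mon_self)
  ultimately have "nakajima_form A T (U + frag_of (j, k)) R ?S \<ge> 0" by (rule Suc.hyps(1)[rotated])
  moreover have "expo (T - z_lin A (U + frag_of (j, k))) j (k + 2) \<ge> 0"
    using U by (simp add: z_lin_add lookup_minus lookup_add lookup_z_mon_self)
  ultimately show ?case by (simp add: nakajima_form_minus_right add.commute)
qed

text \<open>
  The mirror image of the preceding argument: the right argument is lowered at \<open>(j, k - 1)\<close> until its
  exponent at \<open>(j, k + 1)\<close> is no longer positive.
\<close>

lemma nakajima_form_raise_step:
  assumes P: "step_closed R P" and pos: "\<And>S. S \<in> P \<Longrightarrow> nakajima_form A T U R S \<ge> 0"
    and U: "expo (T - z_lin A U) j k < 0"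
  shows "S \<in> P \<Longrightarrow> nakajima_form A T (U - frag_of (j, k)) R S \<ge> 0"
proof (induction "nat (expo (R - z_lin A S) j (k + 1))" arbitrary: S)
  case 0
  then show ?case using pos[of S] by (simp add: nakajima_form_minus_left)
next
  case (Suc n)
  let ?S = "S + frag_of (j, k - 1)"
  have "k - 1 + 2 = k + 1" by simp
  then have "expo (R - z_lin A S) j (k - 1 + 2) > 0" using Suc(2) by (simp only:)
  then have "?S \<in> P" using step_closed_lower[OF P] Suc by blast
  moreover have "n = nat (expo (R - z_lin A ?S) j (k + 1))"
  proof -
    have "expo (z_mon A j (k - 1)) j (k + 1) = 1" by (simp add: lookup_z_mon adj_def)
    then show ?thesis using Suc(2) by (simp add: z_lin_add lookup_minus lookup_add)
  qed
  ultimately have "nakajima_form A T (U - frag_of (j, k)) R ?S \<ge> 0" by (rule Suc.hyps(1)[rotated])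
  moreover have "expo (T - z_lin A (U - frag_of (j, k))) j k \<le> 0"
    using U by (simp add: z_lin_minus lookup_minus lookup_z_mon_self)
  ultimately show ?case by (simp add: nakajima_form_add_right)
qed

lemma step_closed_dual:
  assumes "step_closed R P"
  shows "step_closed T {U. \<forall>S\<in>P. nakajima_form A T U R S \<ge> 0}"
  unfolding step_closed_def
  using nakajima_form_lower_step[OF assms] nakajima_form_raise_step[OF assms] by blast

section \<open>The step closure of a fundamental monomial\<close>

text \<open>
  An element \<open>U\<close> stands for the monomial \<open>y_{i,n} z_U^{-1}\<close>.
\<close>

inductive_set step_closure :: "'i \<Rightarrow> int \<Rightarrow> 'i monomial set" for i n where
  base: "0 \<in> step_closure i n"
| lower: "U \<in> step_closure i n \<Longrightarrow> expo (y_mon i n - z_lin A U) j (k + 2) > 0 \<Longrightarrow>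
    U + frag_of (j, k) \<in> step_closure i n"
| raise: "U \<in> step_closure i n \<Longrightarrow> expo (y_mon i n - z_lin A U) j k < 0 \<Longrightarrow>
    U - frag_of (j, k) \<in> step_closure i n"

lemma step_closed_step_closure: "step_closed (y_mon i n) (step_closure i n)"
  unfolding step_closed_def by (auto intro: step_closure.intros)

lemma step_closure_least:
  assumes "step_closed (y_mon i n) P" "0 \<in> P" "U \<in> step_closure i n"
  shows "U \<in> P"
  using assms(3,1,2) by (induction) (auto simp: step_closed_def)

lemma same_parity_shift: "same_parity I1 j (k - 2) \<longleftrightarrow> same_parity I1 j k"
  "same_parity I1 j (k + 2) \<longleftrightarrow> same_parity I1 j k"
  by (simp_all add: same_parity_def)

lemma same_parity_adj: "adj A j l \<Longrightarrow> same_parity I1 l (k - 1) \<longleftrightarrow> same_parity I1 j k"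
  using bipartite unfolding parity_partition_def same_parity_def by auto

lemma lookup_z_lin_class:
  assumes "\<And>j k. expo U j k \<noteq> 0 \<Longrightarrow> same_parity I1 j k = c" "expo (z_lin A U) j k \<noteq> 0"
  shows "same_parity I1 j k = c"
proof (rule ccontr)
  assume "same_parity I1 j k \<noteq> c"
  then have "expo U j k = 0" "expo U j (k - 2) = 0" "\<And>l. adj A j l \<Longrightarrow> expo U l (k - 1) = 0"
    using assms(1) same_parity_shift same_parity_adj by blast+
  then have "expo (z_lin A U) j k = 0" by (simp add: lookup_z_lin)
  with assms(2) show False by simp
qed

lemma step_closure_parity:
  assumes "U \<in> step_closure i n"
  shows "expo U j k \<noteq> 0 \<Longrightarrow> same_parity I1 j k = same_parity I1 i n"
    and "expo (y_mon i n - z_lin A U) j k \<noteq> 0 \<Longrightarrow> same_parity I1 j k = same_parity I1 i n"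
proof -
  have *: "expo (y_mon i n - z_lin A U) j k \<noteq> 0 \<Longrightarrow> same_parity I1 j k = same_parity I1 i n"
    if "\<And>j k. expo U j k \<noteq> 0 \<Longrightarrow> same_parity I1 j k = same_parity I1 i n" for U j k
    using lookup_z_lin_class[of U "same_parity I1 i n" j k] that
    by (auto simp: lookup_minus lookup_y_mon split: if_splits)
  have 1: "expo U j k \<noteq> 0 \<Longrightarrow> same_parity I1 j k = same_parity I1 i n" for j k
    using assms
  proof (induction arbitrary: j k)
    case base
    then show ?case by simp
  next
    case (lower U j' k')
    have "same_parity I1 j' (k' + 2) = same_parity I1 i n"
      by (rule *) (use lower in auto)
    then show ?case using lower by (auto simp: lookup_add lookup_frag_of same_parity_shift split: if_splits)
  next
    case (raise U j' k')
    have "same_parity I1 j' k' = same_parity I1 i n"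
      by (rule *) (use raise in auto)
    then show ?case using raise by (auto simp: lookup_minus lookup_frag_of split: if_splits)
  qed
  show "expo U j k \<noteq> 0 \<Longrightarrow> same_parity I1 j k = same_parity I1 i n" by (rule 1)
  show "expo (y_mon i n - z_lin A U) j k \<noteq> 0 \<Longrightarrow> same_parity I1 j k = same_parity I1 i n"
    using *[OF 1] by blast
qed

lemma expo_eq:
  "expo (y_mon i n - z_lin A U) j k = (if j = i \<and> k = n then 1 else 0)
     + (\<Sum>l | adj A j l. expo U l (k - 1)) - expo U j k - expo U j (k - 2)"
  by (auto simp: lookup_minus lookup_y_mon lookup_z_lin)

text \<open>
  Each step is matched by enlarging or shrinking a framed module, because the exponent at \<open>(j, k)\<close> is the
  Euler characteristic of the complex
  \<open>V j (k - 2) \<subseteq> framed_space j (k - 2) \<rightarrow> V j k\<close>. Being dimensions, the exponents of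
  \<open>z^{-1}\<close> are then nonnegative, and they vanish above level \<open>n - 2\<close>.
\<close>

lemma step_closure_module:
  assumes "U \<in> step_closure i n"
  shows "\<exists>d. module_dims A i n d \<and> (\<forall>j k. expo U j k = int (d j k))"
  using assms
proof (induction)
  case base
  show ?case using module_dims_zero[of A i n] by force
next
  case (lower U j k)
  then obtain d where d: "module_dims A i n d" and U: "\<And>j k. expo U j k = int (d j k)" by blast
  have "int (d j k + d j (k + 2)) < int ((if j = i \<and> k = n - 2 then 1 else 0) + (\<Sum>l | adj A j l. d l (k + 1)))"
    using lower(2) by (auto simp: expo_eq U add.commute split: if_splits)
  then have "module_dims A i n (d(j := (d j)(k := d j k + 1)))"
    using module_dims_lower[OF d] by (simp only: of_nat_less_iff)
  moreover have "expo (U + frag_of (j, k)) l m = int ((d(j := (d j)(k := d j k + 1))) l m)" for l m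
    by (auto simp: lookup_add lookup_frag_of U)
  ultimately show ?case by blast
next
  case (raise U j k)
  then obtain d where d: "module_dims A i n d" and U: "\<And>j k. expo U j k = int (d j k)" by blast
  have "int ((if j = i \<and> k = n then 1 else 0) + (\<Sum>l | adj A j l. d l (k - 1))) < int (d j k + d j (k - 2))"
    using raise(2) by (auto simp: expo_eq U split: if_splits)
  then have *: "(if j = i \<and> k = n then 1 else 0) + (\<Sum>l | adj A j l. d l (k - 1)) < d j k + d j (k - 2)"
    by (simp only: of_nat_less_iff)
  have "expo (U - frag_of (j, k)) l m = int ((d(j := (d j)(k := d j k - 1))) l m)" for l m
    using module_dims_raise(1)[OF d * adj_sym] by (auto simp: lookup_minus lookup_frag_of U)
  then show ?case using module_dims_raise(2)[OF d * adj_sym] by blast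
qed

lemma step_closure_nonneg: "U \<in> step_closure i n \<Longrightarrow> expo U j k \<ge> 0"
  using step_closure_module by force

lemma step_closure_top: "U \<in> step_closure i n \<Longrightarrow> k > n - 2 \<Longrightarrow> expo U j k = 0"
  using step_closure_module module_dims_top by (metis of_nat_0)

lemma nakajima_form_zero_right [simp]: "nakajima_form A T U R 0 = pairing U (\<lambda>(j, k). expo R j (k + 1))"
  by (simp add: nakajima_form_def case_prod_unfold)

lemma nakajima_form_zero_left [simp]: "nakajima_form A T 0 R S = pairing T (\<lambda>(j, k). expo S j (k - 1))"
  by (simp add: nakajima_form_def)

text \<open>
  By duality it is enough to look at \<open>q = y_{i,n}\<close> and \<open>p = y_{j,c} z_S^{-1}\<close>, where the form is the entry
  \<open>S_i(n - 1) \<ge> 0\<close>.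
\<close>

lemma nakajima_form_fundamental_nonneg:
  assumes "U \<in> step_closure i n" "S \<in> step_closure j c"
  shows "nakajima_form A (y_mon i n) U (y_mon j c) S \<ge> 0"
proof -
  have "U \<in> {U. \<forall>S\<in>step_closure j c. nakajima_form A (y_mon i n) U (y_mon j c) S \<ge> 0}"
    by (rule step_closure_least[OF step_closed_dual[OF step_closed_step_closure] _ assms(1)])
      (auto simp: y_mon_eq_frag_of step_closure_nonneg)
  then show ?thesis using assms(2) by blast
qed

section \<open>Regular data are reached by lowering\<close>

text \<open>
  Here \<open>(i, n)\<close> runs over both parities. For the parity that the notion of regularity leaves out, the form
  vanishes on monomials of the right parity.
\<close>

definition regular_set :: "'i monomial \<Rightarrow> 'i monomial set" where
  "regular_set R = {S. \<forall>i n. \<forall>U\<in>step_closure i n. nakajima_form A (y_mon i n) U R S \<ge> 0}"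

lemma step_closed_regular_set: "step_closed R (regular_set R)"
proof -
  have "step_closed R {S. \<forall>U\<in>step_closure i n. nakajima_form A (y_mon i n) U R S \<ge> 0}" for i n
    using step_closed_dual[OF step_closed_step_closure[of i n], of R] by (simp add: nakajima_form_sym)
  then show ?thesis
    unfolding step_closed_def regular_set_def by blast
qed

lemma regular_set_nonneg:
  assumes "S \<in> regular_set R"
  shows "expo S i n \<ge> 0"
proof -
  have "nakajima_form A (y_mon i (n + 1)) 0 R S \<ge> 0"
    using assms step_closure.base unfolding regular_set_def by blast
  then show ?thesis by (simp add: y_mon_eq_frag_of)
qed

lemma pairing_one_minus: "pairing (U - frag_of x) (\<lambda>_. 1) = pairing U (\<lambda>_. 1) - 1"
  by (simp add: pairing_minus)

text \<open>
  Removing \<open>z_{j,k}^{-1}\<close> from \<open>p\<close> decreases the form by the exponent of \<open>q\<close> at \<open>(j, k + 1)\<close>, so the bound says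
  that the result is still regular. To prove it, raise \<open>q\<close> at negative exponents of level at least
  \<open>k + 1\<close> as long as there are any. This does not increase the form, since all exponents of \<open>p\<close> are
  nonnegative, and it does not decrease the exponent at \<open>(j, k + 1)\<close>, since only raising at level \<open>k\<close> could
  do that. In the end every exponent of \<open>q\<close> that meets \<open>S\<close> is nonnegative, so the form is at least the
  single term at \<open>(j, k + 1)\<close>.
\<close>

lemma firing_bound:
  assumes R: "\<And>m l. expo R m l \<ge> 0" and S: "\<And>m l. expo S m l \<ge> 0"
    and low: "\<And>m l. l < k \<Longrightarrow> expo S m l = 0" and jk: "expo S j k \<ge> 1"
    and dom: "\<And>m l. expo (R - z_lin A S) m l \<ge> 0"
  shows "U \<in> step_closure i n \<Longrightarrow> nakajima_form A (y_mon i n) U R S \<ge> expo (y_mon i n - z_lin A U) j (k + 1)"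
proof (induction "nat (pairing U (\<lambda>_. 1))" arbitrary: U rule: less_induct)
  case less
  let ?q = "y_mon i n - z_lin A U"
  have U: "expo U m l \<ge> 0" for m l using less step_closure_nonneg by blast
  show ?case
  proof (cases "\<exists>m l. l \<ge> k + 1 \<and> expo ?q m l < 0")
    case True
    then obtain m l where ml: "l \<ge> k + 1" "expo ?q m l < 0" by blast
    let ?U = "U - frag_of (m, l)"
    have U': "?U \<in> step_closure i n" using less ml step_closure.raise by blast
    have "pairing ?U (\<lambda>_. 1) \<ge> 0"
      using step_closure_nonneg[OF U'] by (intro pairing_nonneg) auto
    then have "nakajima_form A (y_mon i n) ?U R S \<ge> expo (y_mon i n - z_lin A ?U) j (k + 1)"
      using U' by (intro less) (auto simp: pairing_one_minus)
    moreover have "nakajima_form A (y_mon i n) ?U R S \<le> nakajima_form A (y_mon i n) U R S"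
      using dom by (simp add: nakajima_form_minus_left)
    moreover have "expo ?q j (k + 1) \<le> expo (y_mon i n - z_lin A ?U) j (k + 1)"
      using ml(1) by (auto simp: z_lin_minus lookup_minus lookup_z_mon)
    ultimately show ?thesis by linarith
  next
    case False
    then have nonneg: "expo ?q m l \<ge> 0" if "l \<ge> k + 1" for m l
      using that by (meson not_le)
    have "pairing U (\<lambda>(j, k). expo R j (k + 1)) \<ge> 0"
      using U R by (intro pairing_nonneg) auto
    moreover have "pairing ?q (\<lambda>(j, k). expo S j (k - 1)) \<ge> expo ?q j (k + 1)"
    proof -
      have nn: "Poly_Mapping.lookup ?q x * (case x of (m, l) \<Rightarrow> expo S m (l - 1)) \<ge> 0" for x
      proof (cases x)
        case (Pair m l)
        show ?thesis
        proof (cases "l \<ge> k + 1")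
          case True
          then have "expo ?q m l \<ge> 0" by (rule nonneg)
          then show ?thesis using S by (simp add: Pair)
        next
          case False
          then show ?thesis using low[of "l - 1"] by (simp add: Pair)
        qed
      qed
      show ?thesis
      proof (cases "(j, k + 1) \<in> Poly_Mapping.keys ?q")
        case True
        have "expo ?q j (k + 1) \<ge> 0" by (rule nonneg) simp
        then have "expo ?q j (k + 1) \<le> expo ?q j (k + 1) * expo S j k"
          using jk mult_left_mono by fastforce
        also have "\<dots> = (\<Sum>x\<in>{(j, k + 1)}. Poly_Mapping.lookup ?q x * (case x of (m, l) \<Rightarrow> expo S m (l - 1)))"
          by simp
        also have "\<dots> \<le> pairing ?q (\<lambda>(j, k). expo S j (k - 1))"
          unfolding pairing_def by (rule sum_mono2) (use True nn in auto)
        finally show ?thesis .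
      next
        case False
        then have "expo ?q j (k + 1) = 0" by (simp add: in_keys_iff)
        then show ?thesis using pairing_nonneg[of ?q] nn by force
      qed
    qed
    ultimately show ?thesis unfolding nakajima_form_def by linarith
  qed
qed

definition lowering_closed :: "'i monomial set \<Rightarrow> bool" where
  "lowering_closed M \<longleftrightarrow> (\<forall>p\<in>M. \<forall>j k. expo p j (k + 2) > 0 \<longrightarrow> p - z_mon A j k \<in> M)"

lemma lowest_exponent:
  fixes p :: "'i monomial"
  assumes "p \<noteq> 0"
  obtains j k where "expo p j k \<noteq> 0" "\<And>m l. l < k \<Longrightarrow> expo p m l = 0"
proof -
  let ?X = "snd ` Poly_Mapping.keys p"
  have "?X \<noteq> {}" using assms by simp
  then have "Min ?X \<in> ?X" by (intro Min_in) auto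
  then obtain j where "(j, Min ?X) \<in> Poly_Mapping.keys p" by force
  then have "expo p j (Min ?X) \<noteq> 0" by (simp only: in_keys_iff not_False_eq_True)
  moreover have "expo p m l = 0" if "l < Min ?X" for m l
  proof (rule ccontr)
    assume "expo p m l \<noteq> 0"
    then have "l \<in> ?X" by (force simp: in_keys_iff)
    then have "Min ?X \<le> l" by (intro Min_le) auto
    with that show False by simp
  qed
  ultimately show ?thesis by (rule that)
qed

text \<open>
  Induction on the size of \<open>S\<close>. In each case a factor \<open>z_{j,k}^{-1}\<close> is removed such that the result is
  still regular and has a positive exponent at \<open>(j, k + 2)\<close>; hence it lowers back to the given datum.
\<close>

lemma regular_set_reachable:
  assumes R: "\<And>m l. expo R m l \<ge> 0" and M: "lowering_closed M" "R \<in> M"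
  shows "S \<in> regular_set R \<Longrightarrow> R - z_lin A S \<in> M"
proof (induction "nat (pairing S (\<lambda>_. 1))" arbitrary: S rule: less_induct)
  case less
  have step: "R - z_lin A S \<in> M"
    if S': "S - frag_of (j, k) \<in> regular_set R" and pos: "expo (R - z_lin A S) j (k + 2) \<ge> 0" for j k
  proof -
    let ?S = "S - frag_of (j, k)"
    have "pairing ?S (\<lambda>_. 1) \<ge> 0"
      using regular_set_nonneg[OF S'] by (intro pairing_nonneg) auto
    then have "R - z_lin A ?S \<in> M"
      using S' by (intro less) (auto simp: pairing_one_minus)
    moreover have "expo (R - z_lin A ?S) j (k + 2) > 0"
      using pos by (simp add: z_lin_minus lookup_minus lookup_z_mon_self)
    ultimately have "R - z_lin A ?S - z_mon A j k \<in> M"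
      using M(1) unfolding lowering_closed_def by blast
    then show ?thesis by (simp add: z_lin_minus)
  qed
  show ?case
  proof (cases "\<exists>j k. expo (R - z_lin A S) j k < 0")
    case True
    then obtain j k0 where k0: "expo (R - z_lin A S) j k0 < 0" by blast
    \<comment> \<open>Raising at the largest such level is undone by a lowering step,
      because the exponent two levels higher is nonnegative.\<close>
    let ?K = "{k. expo (R - z_lin A S) j k < 0}"
    have fin: "finite ?K"
    proof (rule finite_subset)
      show "?K \<subseteq> snd ` Poly_Mapping.keys (R - z_lin A S)"
      proof
        fix k assume "k \<in> ?K"
        then have "(j, k) \<in> Poly_Mapping.keys (R - z_lin A S)" by (auto simp: in_keys_iff)
        then show "k \<in> snd ` Poly_Mapping.keys (R - z_lin A S)" by (rule image_eqI[rotated]) simp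
      qed
    qed simp
    have neg: "expo (R - z_lin A S) j (Max ?K) < 0"
      using Max_in[OF fin] k0 by blast
    have "Max ?K + 2 \<notin> ?K"
      using Max_ge[OF fin, of "Max ?K + 2"] by auto
    then have "expo (R - z_lin A S) j (Max ?K + 2) \<ge> 0" by simp
    moreover have "S - frag_of (j, Max ?K) \<in> regular_set R"
      using step_closed_raise[OF step_closed_regular_set less(2) neg] .
    ultimately show ?thesis by (rule step[rotated])
  next
    case False
    then have dom: "expo (R - z_lin A S) j k \<ge> 0" for j k by (meson not_le)
    show ?thesis
    proof (cases "S = 0")
      case True
      then show ?thesis using M by simp
    next
      case False
      \<comment> \<open>No exponent is negative, so a factor of the lowest level is removed, although this is not a step.\<close>
      then obtain j k where jk: "expo S j k \<noteq> 0" and low: "\<And>m l. l < k \<Longrightarrow> expo S m l = 0"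
        using lowest_exponent by blast
      have "expo S j k \<ge> 1" using jk regular_set_nonneg[OF less(2), of j k] by linarith
      then have "nakajima_form A (y_mon i n) U R S \<ge> expo (y_mon i n - z_lin A U) j (k + 1)"
        if "U \<in> step_closure i n" for U i n
        using firing_bound[OF R regular_set_nonneg[OF less(2)] low _ dom that, of k j] by blast
      then have "S - frag_of (j, k) \<in> regular_set R"
        unfolding regular_set_def by (simp add: nakajima_form_minus_right)
      then show ?thesis using step dom by blast
    qed
  qed
qed

end

section \<open>Kashiwara operators are steps\<close>

lemma pairing_indicator [simp]:
  "pairing p (\<lambda>x. if x = y then 1 else 0) = Poly_Mapping.lookup p y"
proof -
  have "pairing p (\<lambda>x. if x = y then 1 else 0) =
      (\<Sum>x\<in>Poly_Mapping.keys p. if x = y then Poly_Mapping.lookup p x else 0)"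
    unfolding pairing_def by (intro sum.cong) auto
  also have "\<dots> = Poly_Mapping.lookup p y" by (simp add: sum.delta in_keys_iff)
  finally show ?thesis .
qed

lemma row_sum_eq_pairing:
  "(\<Sum>l | P l \<and> (j, l) \<in> Poly_Mapping.keys p. expo p j l) =
     pairing p (\<lambda>(i, l). if i = j \<and> P l then 1 else 0)"
proof -
  let ?X = "{x \<in> Poly_Mapping.keys p. fst x = j \<and> P (snd x)}"
  have "(\<Sum>l | P l \<and> (j, l) \<in> Poly_Mapping.keys p. expo p j l) = (\<Sum>x\<in>?X. Poly_Mapping.lookup p x)"
    by (rule sum.reindex_bij_witness[where i = snd and j = "Pair j"]) auto
  also have "\<dots> = (\<Sum>x\<in>Poly_Mapping.keys p. if fst x = j \<and> P (snd x) then Poly_Mapping.lookup p x else 0)"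
    by (rule sum.inter_filter) simp
  also have "\<dots> = pairing p (\<lambda>(i, l). if i = j \<and> P l then 1 else 0)"
    unfolding pairing_def by (intro sum.cong) (auto simp: case_prod_unfold)
  finally show ?thesis .
qed

lemma eps_k_eq: "eps_k j k p = - pairing p (\<lambda>(i, l). if i = j \<and> l \<le> k then 1 else 0)"
  unfolding eps_k_def by (simp only: row_sum_eq_pairing[where P = "\<lambda>l. l \<le> k"])

lemma phi_k_eq: "phi_k j k p = pairing p (\<lambda>(i, l). if i = j \<and> l \<ge> k then 1 else 0)"
  unfolding phi_k_def by (simp only: row_sum_eq_pairing[where P = "\<lambda>l. l \<ge> k"])

lemma eps_k_step: "eps_k j k p = eps_k j (k - 1) p - expo p j k"
proof -
  have "(\<lambda>(i, l). if i = j \<and> l \<le> k then 1 else (0::int)) =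
      (\<lambda>x. (case x of (i, l) \<Rightarrow> if i = j \<and> l \<le> k - 1 then 1 else 0) + (if x = (j, k) then 1 else 0))"
    by (auto simp: fun_eq_iff)
  then show ?thesis by (simp add: eps_k_eq pairing_add_right)
qed

text \<open>
  The weight of the monomial in direction \<open>j\<close>. It is the difference between \<open>phi_k\<close> at \<open>k\<close> and \<open>eps_k\<close> at
  \<open>k - 1\<close>, so that maxima of the one correspond to maxima of the other.
\<close>

definition row_total :: "'i \<Rightarrow> 'i monomial \<Rightarrow> int" where
  "row_total j p = pairing p (\<lambda>(i, l). if i = j then 1 else 0)"

lemma phi_k_eps_k: "phi_k j k p = row_total j p + eps_k j (k - 1) p"
proof -
  have "(\<lambda>(i, l). if i = j then 1 else (0::int)) =
      (\<lambda>x. (case x of (i, l) \<Rightarrow> if i = j \<and> l \<ge> k then 1 else 0) +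
        (case x of (i, l) \<Rightarrow> if i = j \<and> l \<le> k - 1 then 1 else 0))"
    by (auto simp: fun_eq_iff)
  then have "row_total j p = phi_k j k p - eps_k j (k - 1) p"
    unfolding row_total_def by (simp only: eps_k_eq phi_k_eq pairing_add_right)
  then show ?thesis by simp
qed

lemma pairing_z_mon_row:
  "pairing (z_mon A j k) (\<lambda>(i, l). if i = j \<and> P l then 1 else 0) =
     (if P k then 1 else 0) + (if P (k + 2) then 1 else 0)"
proof -
  have "(\<Sum>i | adj A i j. if i = j \<and> P (k + 1) then 1 else (0::int)) = 0"
    by (intro sum.neutral) (auto simp: adj_def)
  then show ?thesis
    by (simp add: z_mon_def pairing_add pairing_minus pairing_sum y_mon_eq_frag_of)
qed

lemma phi_k_add_z_mon:
  "phi_k j m (p + z_mon A j k) = phi_k j m p + (if m \<le> k then 1 else 0) + (if m \<le> k + 2 then 1 else 0)"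
  unfolding phi_k_eq pairing_add using pairing_z_mon_row[of A j k "\<lambda>l. l \<ge> m"] by simp

lemma finite_eps_k: "finite {eps_k j k p | k. P k}"
proof (rule finite_subset)
  show "{eps_k j k p | k. P k} \<subseteq> (\<lambda>B. - (\<Sum>l\<in>B. expo p j l)) ` Pow (snd ` Poly_Mapping.keys p)"
  proof clarify
    fix k assume "P k"
    have "{l. l \<le> k \<and> (j, l) \<in> Poly_Mapping.keys p} \<in> Pow (snd ` Poly_Mapping.keys p)" by force
    then show "eps_k j k p \<in> (\<lambda>B. - (\<Sum>l\<in>B. expo p j l)) ` Pow (snd ` Poly_Mapping.keys p)"
      unfolding eps_k_def by (rule imageI)
  qed
qed simp

lemma finite_phi_k: "finite {phi_k j k p | k. P k}"
proof -
  have "{phi_k j k p | k. P k} \<subseteq> (\<lambda>x. row_total j p + x) ` {eps_k j k p | k. True}"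
    unfolding phi_k_eps_k by blast
  then have "finite {phi_k j k p | k. P k}"
    by (rule finite_subset) (rule finite_imageI[OF finite_eps_k])
  then show ?thesis .
qed

lemma eps_k_low: "\<exists>k0. \<forall>k\<le>k0. eps_k j k p = 0"
proof -
  let ?L = "insert 0 (snd ` Poly_Mapping.keys p)"
  have "eps_k j k p = 0" if "k \<le> Min ?L - 1" for k
  proof -
    have "l > k" if "(j, l) \<in> Poly_Mapping.keys p" for l
    proof -
      have "Min ?L \<le> l" using that by (intro Min_le) force+
      with \<open>k \<le> Min ?L - 1\<close> show ?thesis by linarith
    qed
    then have "{l. l \<le> k \<and> (j, l) \<in> Poly_Mapping.keys p} = {}" by force
    then show ?thesis unfolding eps_k_def by (simp only: sum.empty)
  qed
  then show ?thesis by blast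
qed

lemma phi_k_high: "\<exists>k0. \<forall>k\<ge>k0. phi_k j k p = 0"
proof -
  let ?L = "insert 0 (snd ` Poly_Mapping.keys p)"
  have "phi_k j k p = 0" if "k \<ge> Max ?L + 1" for k
  proof -
    have "l < k" if "(j, l) \<in> Poly_Mapping.keys p" for l
    proof -
      have "Max ?L \<ge> l" using that by (intro Max_ge) force+
      with \<open>k \<ge> Max ?L + 1\<close> show ?thesis by linarith
    qed
    then have "{l. l \<ge> k \<and> (j, l) \<in> Poly_Mapping.keys p} = {}" by force
    then show ?thesis unfolding phi_k_def by (simp only: sum.empty)
  qed
  then show ?thesis by blast
qed

lemma exists_same_parity: "\<exists>k\<ge>k0. same_parity I1 j k" "\<exists>k\<le>k0. same_parity I1 j k"
proof -
  have "same_parity I1 j k0 \<or> same_parity I1 j (k0 + 1)"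
    by (auto simp: same_parity_def)
  then show "\<exists>k\<ge>k0. same_parity I1 j k"
    by (auto intro: exI[of _ k0] exI[of _ "k0 + 1"])
  have "same_parity I1 j k0 \<or> same_parity I1 j (k0 - 1)"
    by (auto simp: same_parity_def)
  then show "\<exists>k\<le>k0. same_parity I1 j k"
    by (auto intro: exI[of _ k0] exI[of _ "k0 - 1"])
qed

lemma eps_ge: "same_parity I1 j k \<Longrightarrow> eps_k j k p \<le> eps I1 j p"
  unfolding eps_def by (rule Max_ge[OF finite_eps_k]) auto

lemma phi_ge: "same_parity I1 j k \<Longrightarrow> phi_k j k p \<le> phi I1 j p"
  unfolding phi_def by (rule Max_ge[OF finite_phi_k]) auto

lemma eps_attained: "\<exists>k. same_parity I1 j k \<and> eps_k j k p = eps I1 j p"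
proof -
  have "eps I1 j p \<in> {eps_k j k p | k. same_parity I1 j k}"
    unfolding eps_def
  proof (rule Max_in[OF finite_eps_k])
    obtain k where "same_parity I1 j k" using exists_same_parity(1)[of 0 I1 j] by blast
    then show "{eps_k j k p | k. same_parity I1 j k} \<noteq> {}" by blast
  qed
  then obtain k where "eps I1 j p = eps_k j k p" "same_parity I1 j k" by blast
  then show ?thesis by (intro exI[of _ k]) simp
qed

lemma phi_attained: "\<exists>k. same_parity I1 j k \<and> phi_k j k p = phi I1 j p"
proof -
  have "phi I1 j p \<in> {phi_k j k p | k. same_parity I1 j k}"
    unfolding phi_def
  proof (rule Max_in[OF finite_phi_k])
    obtain k where "same_parity I1 j k" using exists_same_parity(1)[of 0 I1 j] by blast
    then show "{phi_k j k p | k. same_parity I1 j k} \<noteq> {}" by blast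
  qed
  then obtain k where "phi I1 j p = phi_k j k p" "same_parity I1 j k" by blast
  then show ?thesis by (intro exI[of _ k]) simp
qed

lemma eps_nonneg: "eps I1 j p \<ge> 0"
proof -
  obtain k0 where k0: "\<forall>k\<le>k0. eps_k j k p = 0" using eps_k_low by (rule exE)
  obtain k where k: "k \<le> k0" "same_parity I1 j k"
    using exists_same_parity(2)[of k0 I1 j] by (elim exE conjE)
  show ?thesis using eps_ge[OF k(2), of p] k0[rule_format, OF k(1)] by simp
qed

lemma phi_nonneg: "phi I1 j p \<ge> 0"
proof -
  obtain k0 where k0: "\<forall>k\<ge>k0. phi_k j k p = 0" using phi_k_high by (rule exE)
  obtain k where k: "k \<ge> k0" "same_parity I1 j k"
    using exists_same_parity(1)[of k0 I1 j] by (elim exE conjE)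
  show ?thesis using phi_ge[OF k(2), of p] k0[rule_format, OF k(1)] by simp
qed

lemma exists_least_int:
  fixes P :: "int \<Rightarrow> bool"
  assumes "P k1" "\<And>k. P k \<Longrightarrow> k > k0"
  obtains k where "P k" "\<And>m. P m \<Longrightarrow> k \<le> m"
proof -
  obtain k where k: "P k" "\<forall>m. P m \<longrightarrow> nat (k - k0) \<le> nat (m - k0)"
    using ex_has_least_nat[of P k1 "\<lambda>k. nat (k - k0)"] assms(1) by blast
  have "k \<le> m" if "P m" for m
  proof -
    have "nat (k - k0) \<le> nat (m - k0)" using k(2) that by blast
    then show ?thesis using assms(2)[OF that] by linarith
  qed
  with k(1) show ?thesis by (rule that)
qed

lemma exists_first_eps:
  assumes pos: "eps I1 j p > 0"
  obtains k where "same_parity I1 j k" "eps_k j k p = eps I1 j p"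
    "\<forall>m. same_parity I1 j m \<longrightarrow> eps_k j m p = eps I1 j p \<longrightarrow> k \<le> m"
proof -
  define P where "P k \<longleftrightarrow> same_parity I1 j k \<and> eps_k j k p = eps I1 j p" for k
  obtain k0 where k0: "\<forall>k\<le>k0. eps_k j k p = 0" using eps_k_low by (rule exE)
  have bound: "k > k0" if "P k" for k
  proof (rule ccontr)
    assume "\<not> k > k0"
    then have "eps_k j k p = 0" using k0 by simp
    with that pos show False by (simp add: P_def)
  qed
  obtain k1 where "P k1" using eps_attained unfolding P_def by (rule exE)
  then obtain k where "P k" "\<And>m. P m \<Longrightarrow> k \<le> m" using exists_least_int bound by blast
  then show ?thesis unfolding P_def by (intro that[of k]) simp_all
qed

lemma exists_last_phi:
  assumes pos: "phi I1 j p > 0"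
  obtains k where "same_parity I1 j k" "phi_k j k p = phi I1 j p"
    "\<forall>m. same_parity I1 j m \<longrightarrow> phi_k j m p = phi I1 j p \<longrightarrow> m \<le> k"
proof -
  define P where "P k \<longleftrightarrow> same_parity I1 j (- k) \<and> phi_k j (- k) p = phi I1 j p" for k
  obtain k0 where k0: "\<forall>k\<ge>k0. phi_k j k p = 0" using phi_k_high by (rule exE)
  have bound: "k > - k0" if "P k" for k
  proof (rule ccontr)
    assume "\<not> k > - k0"
    then have "phi_k j (- k) p = 0" using k0 by simp
    with that pos show False by (simp add: P_def)
  qed
  obtain k1 where "same_parity I1 j k1 \<and> phi_k j k1 p = phi I1 j p"
    using phi_attained by (rule exE)
  then have "P (- k1)" by (simp add: P_def)
  then obtain k where k: "P k" "\<And>m. P m \<Longrightarrow> k \<le> m" using exists_least_int bound by blast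
  show ?thesis
  proof (rule that[of "- k"])
    show "\<forall>m. same_parity I1 j m \<longrightarrow> phi_k j m p = phi I1 j p \<longrightarrow> m \<le> - k"
    proof (intro allI impI)
      fix m assume "same_parity I1 j m" "phi_k j m p = phi I1 j p"
      then show "m \<le> - k" using k(2)[of "- m"] by (simp add: P_def)
    qed
  qed (use k(1) in \<open>simp_all add: P_def\<close>)
qed

lemma parity_monomials_zero:
  "p \<in> parity_monomials I1 \<Longrightarrow> \<not> same_parity I1 j k \<Longrightarrow> expo p j k = 0"
  unfolding parity_monomials_def by (auto simp: in_keys_iff)

text \<open>
  The first maximum of \<open>eps_k\<close> is attained at a negative exponent, so the operator is a raising
  step. The new monomial has its last maximum of \<open>phi_k\<close> at \<open>k + 2\<close>, so the lowering operator undoes the step.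
\<close>

lemma e_op_SomeE:
  assumes p: "p \<in> parity_monomials I1" and q: "e_op A I1 j p = Some q"
  obtains k where "expo p j k < 0" "q = p + z_mon A j k" "f_op A I1 j q = Some p"
proof -
  let ?M = "eps I1 j p"
  have pos: "?M > 0" using q eps_nonneg[of I1 j p] unfolding e_op_def by (auto split: if_splits)
  then obtain k where k: "same_parity I1 j k" "eps_k j k p = ?M"
    and first: "\<forall>m. same_parity I1 j m \<longrightarrow> eps_k j m p = ?M \<longrightarrow> k \<le> m"
    by (rule exists_first_eps)
  have least: "k \<le> m" if "same_parity I1 j m" "eps_k j m p = ?M" for m
    using first that by simp
  have "(LEAST k. same_parity I1 j k \<and> eps_k j k p = ?M) = k"
    by (rule Least_equality) (simp_all add: k least)
  then have q_eq: "q = p + z_mon A j k"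
    using q pos unfolding e_op_def by (simp add: add.commute)
  \<comment> \<open>Row \<open>j\<close> has exponents only at levels of the parity of \<open>j\<close>.\<close>
  have even_step: "eps_k j (m - 1) p = eps_k j (m - 2) p" if "same_parity I1 j m" for m
  proof -
    have "\<not> same_parity I1 j (m - 1)" using that by (auto simp: same_parity_def)
    then show ?thesis using eps_k_step[of j "m - 1" p] parity_monomials_zero[OF p] by simp
  qed
  have before: "eps_k j m p < ?M" if "same_parity I1 j m" "m < k" for m
  proof -
    have "eps_k j m p \<noteq> ?M" using least[OF that(1)] that(2) by auto
    then show ?thesis using eps_ge[OF that(1), of p] by simp
  qed
  have par: "same_parity I1 j (m - 2) \<longleftrightarrow> same_parity I1 j m" for m
    by (simp add: same_parity_def)
  have "eps_k j (k - 2) p < ?M" using before[of "k - 2"] k par by simp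
  then have neg: "expo p j k < 0"
    using eps_k_step[of j k p] even_step[of k] k by simp
  have phi_q: "phi_k j m q = row_total j p + eps_k j (m - 2) p
      + (if m \<le> k then 1 else 0) + (if m \<le> k + 2 then 1 else 0)" if "same_parity I1 j m" for m
    using even_step[OF that] unfolding q_eq phi_k_add_z_mon phi_k_eps_k[of j m p] by simp
  let ?N = "row_total j p + ?M + 1"
  have top: "phi_k j (k + 2) q = ?N" and par2: "same_parity I1 j (k + 2)"
  proof -
    show "same_parity I1 j (k + 2)" using k by (simp add: same_parity_def)
    then show "phi_k j (k + 2) q = ?N" using phi_q k by simp
  qed
  have less: "phi_k j m q \<le> ?N" "m > k + 2 \<Longrightarrow> phi_k j m q < ?N" if "same_parity I1 j m" for m
  proof -
    have 1: "eps_k j (m - 2) p \<le> ?M" using eps_ge[of I1 j "m - 2" p] par[of m] that by simp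
    show "m > k + 2 \<Longrightarrow> phi_k j m q < ?N" using phi_q[OF that] 1 by simp
    have "eps_k j (m - 2) p < ?M" if "m \<le> k"
      using before[of "m - 2"] that par \<open>same_parity I1 j m\<close> by simp
    then show "phi_k j m q \<le> ?N" using phi_q[OF that] 1 by (auto split: if_splits)
  qed
  have phi: "phi I1 j q = ?N"
    unfolding phi_def using finite_phi_k
  proof (rule Max_eqI)
    show "?N \<in> {phi_k j m q | m. same_parity I1 j m}"
      using top par2 by (intro CollectI exI[of _ "k + 2"]) simp
    fix y assume "y \<in> {phi_k j m q | m. same_parity I1 j m}"
    then show "y \<le> ?N" by (elim CollectE exE conjE) (simp only: less(1))
  qed
  have "?N > 0"
  proof -
    obtain m0 where m0: "\<forall>m\<ge>m0. phi_k j m p = 0" using phi_k_high by (rule exE)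
    obtain m where m: "m \<ge> m0" "same_parity I1 j m"
      using exists_same_parity(1)[of m0 I1 j] by (elim exE conjE)
    then have "row_total j p + eps_k j (m - 2) p = 0"
      using m0[rule_format, OF m(1)] even_step[of m] unfolding phi_k_eps_k by simp
    then show ?thesis using eps_ge[of I1 j "m - 2" p] par m(2) by simp
  qed
  moreover have "(GREATEST m. same_parity I1 j m \<and> phi_k j m q = phi I1 j q) = k + 2"
  proof (rule Greatest_equality)
    show "same_parity I1 j (k + 2) \<and> phi_k j (k + 2) q = phi I1 j q"
      using top par2 phi by simp
    fix m assume m: "same_parity I1 j m \<and> phi_k j m q = phi I1 j q"
    then have "\<not> phi_k j m q < ?N" using phi by simp
    then show "m \<le> k + 2" using less(2)[of m] m by linarith
  qed
  ultimately have "f_op A I1 j q = Some p"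
    unfolding f_op_def phi by (simp add: q_eq)
  with neg q_eq show ?thesis by (rule that)
qed

text \<open>
  The last maximum of \<open>phi_k\<close> is attained at a positive exponent.
\<close>

lemma f_op_SomeE:
  assumes p: "p \<in> parity_monomials I1" and q: "f_op A I1 j p = Some q"
  obtains k where "expo p j (k + 2) > 0" "q = p - z_mon A j k"
proof -
  let ?M = "phi I1 j p"
  have pos: "?M > 0" using q phi_nonneg[of I1 j p] unfolding f_op_def by (auto split: if_splits)
  then obtain k where k: "same_parity I1 j k" "phi_k j k p = ?M"
    and last: "\<forall>m. same_parity I1 j m \<longrightarrow> phi_k j m p = ?M \<longrightarrow> m \<le> k"
    by (rule exists_last_phi)
  have great: "m \<le> k" if "same_parity I1 j m" "phi_k j m p = ?M" for m
    using last that by simp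
  have "(GREATEST k. same_parity I1 j k \<and> phi_k j k p = ?M) = k"
    by (rule Greatest_equality) (simp_all add: k great)
  then have q_eq: "q = p - z_mon A j (k - 2)"
    using q pos unfolding f_op_def by simp
  have par: "same_parity I1 j (k + 2)" "\<not> same_parity I1 j (k + 1)"
    using k(1) by (auto simp: same_parity_def)
  have "phi_k j (k + 2) p \<noteq> ?M" using great[OF par(1)] by auto
  then have "phi_k j (k + 2) p < ?M" using phi_ge[OF par(1), of p] by simp
  moreover have "phi_k j k p = phi_k j (k + 2) p + expo p j k"
    using eps_k_step[of j k p] eps_k_step[of j "k + 1" p] parity_monomials_zero[OF p par(2)]
    by (simp add: phi_k_eps_k add.commute)
  ultimately have "expo p j (k - 2 + 2) > 0" using k(2) by simp
  then show ?thesis using q_eq by (rule that)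
qed

lemma lookup_shift [simp]:
  fixes p :: "'i monomial"
  shows "expo (shift p) j k = expo p j (k - 1)"
proof -
  have inj: "inj (\<lambda>(j :: 'i, k :: int). (j, k - 1))" by (auto simp: inj_def)
  have "Poly_Mapping.lookup (shift p) = Poly_Mapping.lookup p \<circ> (\<lambda>(j, k). (j, k - 1))"
    unfolding shift_def by (rule map_key.rep_eq[OF inj])
  then show ?thesis by simp
qed

context bipartite_diagram
begin

definition fundamental_set :: "'i \<Rightarrow> int \<Rightarrow> 'i monomial set" where
  "fundamental_set i n = (\<lambda>U. y_mon i n - z_lin A U) ` step_closure i n"

lemma fundamental_set_parity:
  assumes "p \<in> fundamental_set i n" "same_parity I1 i n"
  shows "p \<in> parity_monomials I1"
  using assms step_closure_parity(2) unfolding fundamental_set_def parity_monomials_def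
  by (auto simp: in_keys_iff)

lemma fundamental_set_raise:
  "p \<in> fundamental_set i n \<Longrightarrow> expo p j k < 0 \<Longrightarrow> p + z_mon A j k \<in> fundamental_set i n"
  unfolding fundamental_set_def
  by (auto intro!: image_eqI[OF _ step_closure.raise] simp: z_lin_minus)

lemma lowering_closed_fundamental_set: "lowering_closed (fundamental_set i n)"
  unfolding fundamental_set_def lowering_closed_def
  by (auto intro!: image_eqI[OF _ step_closure.lower] simp: z_lin_add)

text \<open>
  At the lowest level \<open>k\<close> of \<open>U\<close> the monomial has the exponents \<open>-U_j(k)\<close>, and below that level it has none.
  So one of its partial sums is negative.
\<close>

lemma step_closure_raisable:
  assumes U: "U \<in> step_closure i n" "U \<noteq> 0" and par: "same_parity I1 i n"
  shows "\<exists>j. eps I1 j (y_mon i n - z_lin A U) \<noteq> 0"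
proof -
  let ?p = "y_mon i n - z_lin A U"
  obtain j k where jk: "expo U j k \<noteq> 0" and zero: "\<And>m l. l < k \<Longrightarrow> expo U m l = 0"
    using lowest_exponent U(2) by blast
  have "k \<le> n - 2" using step_closure_top[OF U(1), of k j] jk by linarith
  then have "expo ?p j l = - expo U j l" if "l \<le> k" for l
    using that zero unfolding expo_eq by simp
  with zero have p: "expo ?p j l = 0" if "l < k" for l using that by simp
  have "{l. l \<le> k - 1 \<and> (j, l) \<in> Poly_Mapping.keys ?p} = {}" using p by (auto simp: in_keys_iff)
  then have "eps_k j (k - 1) ?p = 0" unfolding eps_k_def by (simp only: sum.empty)
  then have "eps_k j k ?p = expo U j k"
    using eps_k_step[of j k ?p] \<open>\<And>l. l \<le> k \<Longrightarrow> expo ?p j l = - expo U j l\<close> by simp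
  moreover have "expo U j k > 0" using jk step_closure_nonneg[OF U(1), of j k] by linarith
  moreover have "same_parity I1 j k" using step_closure_parity(1)[OF U(1) jk] par by simp
  ultimately have "eps I1 j ?p > 0" using eps_ge[of I1 j k ?p] by linarith
  then show ?thesis by (intro exI[of _ j]) simp
qed

text \<open>
  For the inclusion of the step closure in the crystal, raise by a Kashiwara operator, use induction on
  the size of \<open>U\<close>, and undo the operator by the opposite one.
\<close>

lemma generated_crystal_eq:
  assumes par: "same_parity I1 i n"
  shows "generated_crystal A I1 i n = fundamental_set i n"
proof (intro equalityI subsetI)
  fix p assume "p \<in> generated_crystal A I1 i n"
  then show "p \<in> fundamental_set i n"
  proof induction
    case gen
    have "y_mon i n = y_mon i n - z_lin A 0" by simp
    then show ?case unfolding fundamental_set_def using step_closure.base by blast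
  next
    case (e p j q)
    with fundamental_set_parity[OF _ par] obtain k where "expo p j k < 0" "q = p + z_mon A j k"
      by (metis e_op_SomeE)
    with e show ?case using fundamental_set_raise by blast
  next
    case (f p j q)
    with fundamental_set_parity[OF _ par] obtain k where "expo p j (k + 2) > 0" "q = p - z_mon A j k"
      by (metis f_op_SomeE)
    with f show ?case using lowering_closed_fundamental_set unfolding lowering_closed_def by blast
  qed
next
  have "y_mon i n - z_lin A U \<in> generated_crystal A I1 i n" if "U \<in> step_closure i n" for U
    using that
  proof (induction "nat (pairing U (\<lambda>_. 1))" arbitrary: U rule: less_induct)
    case less
    let ?p = "y_mon i n - z_lin A U"
    show ?case
    proof (cases "U = 0")
      case True
      then show ?thesis using generated_crystal.gen by simp
    next
      case False
      then obtain j where "eps I1 j ?p \<noteq> 0" using step_closure_raisable less par by blast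
      then obtain q where "e_op A I1 j ?p = Some q" unfolding e_op_def by simp
      moreover have "?p \<in> parity_monomials I1"
        using less par by (intro fundamental_set_parity) (auto simp: fundamental_set_def)
      ultimately obtain k where k: "expo ?p j k < 0" "q = ?p + z_mon A j k" "f_op A I1 j q = Some ?p"
        by (metis e_op_SomeE)
      let ?U = "U - frag_of (j, k)"
      have U: "?U \<in> step_closure i n" using less(2) k(1) by (rule step_closure.raise)
      have "pairing ?U (\<lambda>_. 1) \<ge> 0"
        using step_closure_nonneg[OF U] by (intro pairing_nonneg) auto
      then have "y_mon i n - z_lin A ?U \<in> generated_crystal A I1 i n"
        using U by (intro less) (auto simp: pairing_one_minus)
      moreover have "y_mon i n - z_lin A ?U = q" by (simp add: k(2) z_lin_minus)
      ultimately show ?thesis using generated_crystal.f k(3) by metis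
    qed
  qed
  then show "\<And>p. p \<in> fundamental_set i n \<Longrightarrow> p \<in> generated_crystal A I1 i n"
    unfolding fundamental_set_def by blast
qed

lemma shift_add: "shift (p + q) = shift p + shift (q :: 'i monomial)"
  by (rule poly_mapping_eqI) (auto simp: lookup_add)

lemma shift_minus: "shift (p - q) = shift p - shift (q :: 'i monomial)"
  by (rule poly_mapping_eqI) (auto simp: lookup_minus)

lemma shift_z_lin: "shift (z_lin A U) = z_lin A (shift U)"
  by (rule poly_mapping_eqI) (auto simp: lookup_z_lin algebra_simps)

lemma shift_frag_of: "shift (frag_of (j :: 'i, k)) = frag_of (j, k + 1)"
  using shift_y_mon[of j k] by (simp add: y_mon_eq_frag_of)

lemma shift_zero [simp]: "shift (0 :: 'i monomial) = 0"
  by (rule poly_mapping_eqI) auto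

lemma shift_monomial: "shift (y_mon i n - z_lin A U) = y_mon i (n + 1) - z_lin A (shift U)"
  by (simp add: shift_minus shift_y_mon shift_z_lin)

lemma step_closure_shift: "step_closure i (n + 1) = shift ` step_closure i n"
proof (intro equalityI subsetI)
  fix U assume "U \<in> step_closure i (n + 1)"
  then show "U \<in> shift ` step_closure i n"
  proof induction
    case base
    have "0 = shift (0 :: 'i monomial)" by simp
    then show ?case using step_closure.base by blast
  next
    case (lower U j k)
    then obtain V where V: "U = shift V" "V \<in> step_closure i n" by blast
    have "expo (shift (y_mon i n - z_lin A V)) j (k + 2) > 0"
      using lower(2) by (simp only: shift_monomial V(1))
    then have "V + frag_of (j, k - 1) \<in> step_closure i n"
      using V(2) by (intro step_closure.lower) (auto simp: algebra_simps)
    moreover have "U + frag_of (j, k) = shift (V + frag_of (j, k - 1))"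
      by (simp add: V(1) shift_add shift_frag_of)
    ultimately show ?case by blast
  next
    case (raise U j k)
    then obtain V where V: "U = shift V" "V \<in> step_closure i n" by blast
    have "expo (shift (y_mon i n - z_lin A V)) j k < 0"
      using raise(2) by (simp only: shift_monomial V(1))
    then have "V - frag_of (j, k - 1) \<in> step_closure i n"
      using V(2) by (intro step_closure.raise) auto
    moreover have "U - frag_of (j, k) = shift (V - frag_of (j, k - 1))"
      by (simp add: V(1) shift_minus shift_frag_of)
    ultimately show ?case by blast
  qed
next
  fix U assume "U \<in> shift ` step_closure i n"
  then obtain V where "V \<in> step_closure i n" "U = shift V" by blast
  then show "U \<in> step_closure i (n + 1)"
  proof (induction arbitrary: U)
    case base
    then show ?case by (simp add: step_closure.base)
  next
    case (lower V j k)
    have "expo (shift (y_mon i n - z_lin A V)) j (k + 1 + 2) > 0"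
      using lower(2) by (simp add: algebra_simps)
    then have "shift V + frag_of (j, k + 1) \<in> step_closure i (n + 1)"
      using lower(3) by (intro step_closure.lower) (simp_all only: shift_monomial)
    then show ?case using lower(4) by (simp add: shift_add shift_frag_of)
  next
    case (raise V j k)
    have "expo (shift (y_mon i n - z_lin A V)) j (k + 1) < 0"
      using raise(2) by simp
    then have "shift V - frag_of (j, k + 1) \<in> step_closure i (n + 1)"
      using raise(3) by (intro step_closure.raise) (simp_all only: shift_monomial)
    then show ?case using raise(4) by (simp add: shift_minus shift_frag_of)
  qed
qed

lemma fundamental_crystal_eq: "fundamental_crystal A I1 i n = fundamental_set i n"
proof (cases "same_parity I1 i n")
  case True
  then show ?thesis by (simp add: fundamental_crystal_def generated_crystal_eq)
next
  case False
  then have "same_parity I1 i (n - 1)" by (auto simp: same_parity_def)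
  then have "fundamental_crystal A I1 i n = shift ` fundamental_set i (n - 1)"
    using False by (simp add: fundamental_crystal_def generated_crystal_eq)
  also have "\<dots> = fundamental_set i n"
    using step_closure_shift[of i "n - 1"]
    by (simp add: fundamental_set_def image_image shift_monomial)
  finally show ?thesis .
qed

end

section \<open>Multisets as finitely supported functions\<close>

lemma lookup_y_prod: "expo (y_prod S) i k = int (count (S i) k)"
proof -
  have "expo (\<Sum>k\<in>#M. y_mon j k) i k = (if j = i then int (count M k) else 0)" for j and M :: "int multiset"
    by (induction M) (auto simp: lookup_add lookup_y_mon)
  then have "expo (y_prod S) i k = (\<Sum>j\<in>UNIV. if j = i then int (count (S j) k) else 0)"
    by (simp add: y_prod_def lookup_sum)
  then show ?thesis by simp
qed

lemma z_lin_y_prod: "z_lin A (y_prod S) = z_prod A S"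
  by (rule poly_mapping_eqI) (auto simp: lookup_z_lin lookup_z_prod lookup_y_prod)

lemma nonneg_eq_y_prod:
  fixes U :: "'i::finite monomial"
  assumes "\<And>j k. expo U j k \<ge> 0"
  obtains S where "U = y_prod S"
proof -
  define S where "S j = Abs_multiset (\<lambda>k. nat (expo U j k))" for j
  have "count (S j) k = nat (expo U j k)" for j k
  proof -
    have "{k. 0 < nat (expo U j k)} \<subseteq> snd ` Poly_Mapping.keys U"
    proof
      fix k assume "k \<in> {k. 0 < nat (expo U j k)}"
      then have "(j, k) \<in> Poly_Mapping.keys U" by (auto simp: in_keys_iff)
      then show "k \<in> snd ` Poly_Mapping.keys U" by (rule image_eqI[rotated]) simp
    qed
    then have "finite {k. 0 < nat (expo U j k)}" by (rule finite_subset) simp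
    then show ?thesis unfolding S_def by (simp only: count_Abs_multiset)
  qed
  then have "U = y_prod S" using assms by (intro poly_mapping_eqI) (auto simp: lookup_y_prod)
  then show ?thesis by (rule that)
qed

context bipartite_diagram
begin

lemma E_val_eq:
  "E_val A R i n (y_mon i n - z_prod A U) (y_prod R - z_prod A S) =
     nakajima_form A (y_mon i n) (y_prod U) (y_prod R) (y_prod S)"
proof -
  have keys: "Poly_Mapping.keys (y_prod U) = Sigma UNIV (\<lambda>j. set_mset (U j))"
    by (auto simp: in_keys_iff lookup_y_prod)
  have "(\<Sum>j\<in>UNIV. \<Sum>k\<in>set_mset (U j). int (count (U j) k) * int (count (R j) (k + 1))) =
      pairing (y_prod U) (\<lambda>(j, k). expo (y_prod R) j (k + 1))"
    unfolding pairing_def keys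
    by (subst sum.Sigma) (auto simp: lookup_y_prod intro!: sum.cong)
  moreover have "(\<Sum>(j, k)\<in>Poly_Mapping.keys q. expo q j k * int (count (S j) (k - 1))) =
      pairing q (\<lambda>(j, k). expo (y_prod S) j (k - 1))" for q
    unfolding pairing_def by (intro sum.cong) (auto simp: lookup_y_prod)
  ultimately show ?thesis
    unfolding E_val_def z_exponents_eq Let_def nakajima_form_def z_lin_y_prod by simp
qed

text \<open>
  Every term pairs two entries of which at least one has the wrong parity and is zero.
\<close>

lemma nakajima_form_same_class:
  assumes "U \<in> step_closure i n" "same_parity I1 i n"
    and p: "R - z_lin A S \<in> parity_monomials I1" and S: "\<And>j k. expo S j k \<noteq> 0 \<Longrightarrow> same_parity I1 j k"
  shows "nakajima_form A (y_mon i n) U R S = 0"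
proof -
  have "expo S i (n - 1) = 0"
    using S[of i "n - 1"] assms(2) by (auto simp: same_parity_def)
  moreover have "pairing U (\<lambda>(j, k). expo (R - z_lin A S) j (k + 1)) = 0"
    unfolding pairing_def
  proof (intro sum.neutral ballI)
    fix x assume "x \<in> Poly_Mapping.keys U"
    moreover obtain j k where x: "x = (j, k)" by force
    ultimately have "same_parity I1 j k"
      using step_closure_parity(1)[OF assms(1), of j k] assms(2) by (simp add: in_keys_iff)
    then have "\<not> same_parity I1 j (k + 1)" by (auto simp: same_parity_def)
    then show "Poly_Mapping.lookup U x * (case x of (j, k) \<Rightarrow> expo (R - z_lin A S) j (k + 1)) = 0"
      using parity_monomials_zero[OF p] by (simp add: x)
  qed
  ultimately show ?thesis by (simp add: nakajima_form_alt y_mon_eq_frag_of)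
qed

lemma regular_iff:
  assumes p: "y_prod R - z_prod A S \<in> parity_monomials I1" and S: "integral I1 S"
  shows "regular A I1 R (y_prod R - z_prod A S) \<longleftrightarrow> y_prod S \<in> regular_set (y_prod R)"
proof -
  have E: "E_val A R i n (y_mon i n - z_lin A U) (y_prod R - z_prod A S) =
      nakajima_form A (y_mon i n) U (y_prod R) (y_prod S)" if U: "U \<in> step_closure i n" for i n U
  proof -
    obtain T where T: "U = y_prod T"
      using nonneg_eq_y_prod step_closure_nonneg[OF U] by blast
    show ?thesis unfolding T z_lin_y_prod by (rule E_val_eq)
  qed
  have zero: "nakajima_form A (y_mon i n) U (y_prod R) (y_prod S) = 0"
    if "U \<in> step_closure i n" "\<not> same_parity I1 i (n + 1)" for i n U
  proof (rule nakajima_form_same_class[OF that(1)])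
    show "same_parity I1 i n" using that(2) by (auto simp: same_parity_def)
    show "y_prod R - z_lin A (y_prod S) \<in> parity_monomials I1" using p by (simp add: z_lin_y_prod)
    show "same_parity I1 j k" if "expo (y_prod S) j k \<noteq> 0" for j k
      using that S by (auto simp: lookup_y_prod integral_def)
  qed
  have "regular A I1 R (y_prod R - z_prod A S) \<longleftrightarrow> (\<forall>i n. same_parity I1 i (n + 1) \<longrightarrow>
      (\<forall>U\<in>step_closure i n. nakajima_form A (y_mon i n) U (y_prod R) (y_prod S) \<ge> 0))"
    unfolding regular_def fundamental_crystal_eq fundamental_set_def by (simp add: E)
  also have "\<dots> \<longleftrightarrow> (\<forall>i n. \<forall>U\<in>step_closure i n. nakajima_form A (y_mon i n) U (y_prod R) (y_prod S) \<ge> 0)"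
  proof (intro iffI allI ballI)
    fix i n U
    assume "\<forall>i n. same_parity I1 i (n + 1) \<longrightarrow>
        (\<forall>U\<in>step_closure i n. nakajima_form A (y_mon i n) U (y_prod R) (y_prod S) \<ge> 0)"
      and "U \<in> step_closure i n"
    then show "nakajima_form A (y_mon i n) U (y_prod R) (y_prod S) \<ge> 0"
      using zero[of U i n] by (cases "same_parity I1 i (n + 1)") simp_all
  qed simp
  finally show ?thesis by (simp add: regular_set_def)
qed

section \<open>Products of fundamental crystals\<close>

text \<open>
  A positive exponent of a product is positive in one of the factors, and this factor can be lowered.
\<close>

lemma lowering_closed_plus:
  assumes "lowering_closed X" "lowering_closed Y"
  shows "lowering_closed (X + Y)"
  unfolding lowering_closed_def
proof (intro ballI allI impI)
  fix p j k assume "p \<in> X + Y" and pos: "expo p j (k + 2) > 0"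
  then obtain x y where p: "p = x + y" "x \<in> X" "y \<in> Y" by (auto elim: set_plus_elim)
  then consider "expo x j (k + 2) > 0" | "expo y j (k + 2) > 0"
    using pos by (fastforce simp: lookup_add)
  then show "p - z_mon A j k \<in> X + Y"
  proof cases
    case 1
    then have "x - z_mon A j k \<in> X" using assms(1) p unfolding lowering_closed_def by blast
    then have "(x - z_mon A j k) + y \<in> X + Y" using p(3) by (rule set_plus_intro)
    then show ?thesis by (simp add: p(1) algebra_simps)
  next
    case 2
    then have "y - z_mon A j k \<in> Y" using assms(2) p unfolding lowering_closed_def by blast
    then have "x + (y - z_mon A j k) \<in> X + Y" using p(2) by (intro set_plus_intro)
    then show ?thesis by (simp add: p(1) algebra_simps)
  qed
qed

lemma lowering_closed_zero: "lowering_closed {0}"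
  by (simp add: lowering_closed_def)

lemma lowering_closed_sum:
  "(\<And>x. x \<in> X \<Longrightarrow> lowering_closed (f x)) \<Longrightarrow> lowering_closed (\<Sum>x\<in>X. f x)"
  by (induction X rule: infinite_finite_induct) (auto intro: lowering_closed_zero lowering_closed_plus)

lemma lowering_closed_sum_mset:
  "(\<And>x. lowering_closed (f x)) \<Longrightarrow> lowering_closed (\<Sum>x\<in>#M. f x)"
  by (induction M) (auto intro: lowering_closed_zero lowering_closed_plus)

lemma lowering_closed_product: "lowering_closed (product_monomial_crystal A I1 R)"
  unfolding product_monomial_crystal_def fundamental_crystal_eq
  by (intro lowering_closed_sum lowering_closed_sum_mset lowering_closed_fundamental_set)

lemma y_prod_in_product: "y_prod R \<in> product_monomial_crystal A I1 R"
proof -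
  have y: "y_mon i c \<in> fundamental_set i c" for i c
  proof -
    have "y_mon i c = y_mon i c - z_lin A 0" by simp
    then show ?thesis unfolding fundamental_set_def using step_closure.base by blast
  qed
  have "(\<Sum>c\<in>#M. y_mon i c) \<in> (\<Sum>c\<in>#M. fundamental_set i c)" for i M
    by (induction M) (auto intro: y)
  moreover have "(\<Sum>i\<in>X. f i) \<in> (\<Sum>i\<in>X. F i)" if "\<And>i. f i \<in> F i"
    for X :: "'i set" and f and F :: "'i \<Rightarrow> 'i monomial set"
    by (induction X rule: infinite_finite_induct) (auto intro: that)
  ultimately show ?thesis
    unfolding product_monomial_crystal_def fundamental_crystal_eq y_prod_def by simp
qed

text \<open>
  The monomials of the regular exponents \<open>S\<close>. This form of regularity makes sense for every \<open>R\<close> and is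
  compatible with products.
\<close>

definition regular_data :: "'i monomial \<Rightarrow> 'i monomial set" where
  "regular_data R = (\<lambda>S. R - z_lin A S) ` regular_set R"

lemma regular_data_plus:
  assumes "X \<subseteq> regular_data R" "Y \<subseteq> regular_data R'"
  shows "X + Y \<subseteq> regular_data (R + R')"
proof
  fix p assume "p \<in> X + Y"
  then obtain x y where xy: "p = x + y" "x \<in> regular_data R" "y \<in> regular_data R'"
    using assms by (elim set_plus_elim) blast
  then obtain S S' where S: "S \<in> regular_set R" "S' \<in> regular_set R'"
    and p: "p = (R - z_lin A S) + (R' - z_lin A S')"
    unfolding regular_data_def by auto
  have "nakajima_form A T U (R + R') (S + S') = nakajima_form A T U R S + nakajima_form A T U R' S'" for T U
    by (simp add: nakajima_form_def lookup_add case_prod_unfold pairing_add_right)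
  then have "S + S' \<in> regular_set (R + R')"
    using S unfolding regular_set_def by (simp add: add_nonneg_nonneg)
  moreover have "p = (R + R') - z_lin A (S + S')" by (simp add: p z_lin_add algebra_simps)
  ultimately show "p \<in> regular_data (R + R')" unfolding regular_data_def by blast
qed

lemma regular_data_zero: "0 \<in> regular_data 0"
proof -
  have "0 \<in> regular_set 0"
    by (simp add: regular_set_def case_prod_unfold)
  then have "(\<lambda>S. 0 - z_lin A S) 0 \<in> regular_data 0" unfolding regular_data_def by (rule imageI)
  then show ?thesis by simp
qed

lemma product_subset_regular_data: "product_monomial_crystal A I1 R \<subseteq> regular_data (y_prod R)"
proof -
  have fund: "fundamental_set i c \<subseteq> regular_data (y_mon i c)" for i c
    unfolding fundamental_set_def regular_data_def
  proof (rule image_mono, rule subsetI)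
    fix S assume "S \<in> step_closure i c"
    then show "S \<in> regular_set (y_mon i c)"
      by (simp add: regular_set_def nakajima_form_fundamental_nonneg)
  qed
  have mset: "(\<Sum>c\<in>#M. fundamental_set i c) \<subseteq> regular_data (\<Sum>c\<in>#M. y_mon i c)" for i M
    by (induction M) (simp_all add: regular_data_zero regular_data_plus fund)
  have "(\<Sum>i\<in>X. F i) \<subseteq> regular_data (\<Sum>i\<in>X. f i)" if "\<And>i. F i \<subseteq> regular_data (f i)"
    for X :: "'i set" and f F
    by (induction X rule: infinite_finite_induct) (simp_all add: regular_data_zero regular_data_plus that)
  from this[OF mset] show ?thesis
    unfolding product_monomial_crystal_def fundamental_crystal_eq y_prod_def .
qed

end

theorem theorem6p4:
  fixes A :: "'i::finite \<Rightarrow> 'i \<Rightarrow> int"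
    and I1 :: "'i set"
    and R :: "'i \<Rightarrow> int multiset"
    and p :: "'i monomial"
  assumes "finite_type_cartan_matrix A"
    and "simply_laced A"
    and "parity_partition A I1"
    and "integral I1 R"
    and "monomial_datum A I1 R p"
  shows "regular A I1 R p \<longleftrightarrow> p \<in> product_monomial_crystal A I1 R"
proof -
  interpret bipartite_diagram A I1
  proof
    show "adj A i j \<longleftrightarrow> adj A j i" for i j
      using assms(1) unfolding finite_type_cartan_matrix_def adj_def by metis
  qed (rule assms(3))
  from assms(5) obtain S where par: "p \<in> parity_monomials I1" and S: "integral I1 S"
    and p: "p = y_prod R - z_prod A S"
    unfolding monomial_datum_def by blast
  have reg: "regular A I1 R p \<longleftrightarrow> y_prod S \<in> regular_set (y_prod R)"
    using regular_iff par S unfolding p by blast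
  show ?thesis
  proof
    assume "regular A I1 R p"
    then have "y_prod R - z_lin A (y_prod S) \<in> product_monomial_crystal A I1 R"
      using reg by (intro regular_set_reachable lowering_closed_product y_prod_in_product)
        (auto simp: lookup_y_prod)
    then show "p \<in> product_monomial_crystal A I1 R" by (simp add: p z_lin_y_prod)
  next
    assume "p \<in> product_monomial_crystal A I1 R"
    then obtain S' where S': "S' \<in> regular_set (y_prod R)" and p': "p = y_prod R - z_lin A S'"
      using product_subset_regular_data unfolding regular_data_def by blast
    obtain T where T: "S' = y_prod T"
      using nonneg_eq_y_prod regular_set_nonneg[OF S'] by blast
    have "z_prod A T = z_prod A S" using p p' unfolding T z_lin_y_prod by simp
    then have "T = S" by (rule z_prod_inject)
    then show "regular A I1 R p" using reg S' T by simp
  qed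
qed

end
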